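(* Let $W(\hbar,j)=\hbar\log Z^{\varphi^3}(\hbar,j)$ be the generating function of connected diagrams of zero-dimensional $\varphi^3$-theory. Then for each $m\ge0$ the series $\partial_j^mW|_{j=0}$ has a factorial asymptotic expansion with $A=\frac23$, and, coefficientwise in $j$, $$\mathcal{A}^{\frac23}_\hbar W(\hbar,j)=\hbar\left[e^{\frac23\left(\frac1\hbar-\frac1{\widetilde\hbar}\right)}\,\mathcal{A}^{\frac23}_{\widetilde\hbar}\log Z_0(\widetilde\hbar)\right]_{\widetilde\hbar=\frac{\hbar}{(1-2j)^{3/2}}},\qquad \mathcal{A}^{\frac23}_\hbar\log Z_0(\hbar)=\frac{1}{2\pi}\frac{Z_0(-\hbar)}{Z_0(\hbar)}.$$
   Context: $Z_0(\hbar)=\sum_{n\ge0}\hbar^n\frac{(6n-1)!!}{(3!)^{2n}(2n)!}$, and the free energy is the formal power series in $\hbar$ and $j$ $$W(\hbar,j)=\tfrac13\big((1-2j)^{3/2}-1+3j\big)+\tfrac14\hbar\log\tfrac{1}{1-2j}+\hbar\log Z_0\!\left(\frac{\hbar}{(1-2j)^{3/2}}\right).$$ Asymptotic operator: a power (or Laurent, with finitely many negative powers) series $f(\hbar)=\sum_n f_n\hbar^n$ has a factorial asymptotic expansion with parameter $A>0$ if there are $\beta\in\mathbb{R}$ and $c_k\in\mathbb{R}$ with $f_n=\sum_{k=0}^{R-1}c_kA^{-n-\beta+k}\Gamma(n+\beta-k)+\mathcal{O}(A^{-n}\Gamma(n+\beta-R))$ as $n\to\infty$ for all $R\ge0$.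 Then $(\mathcal{A}^A_\hbar f)(\hbar):=\hbar^{-\beta}\sum_{k\ge0}c_k\hbar^k$. For series in $j$ with coefficients in $\hbar$, $\mathcal{A}^A_\hbar$ acts on each coefficient of $j^m$. *)

theory Defs
  imports
    "HOL-Analysis.Gamma_Function"
    "HOL-Library.Landau_Symbols"
    "HOL-Computational_Algebra.Formal_Laurent_Series"
begin

text \<open>
  Series in \<open>hbar\<close> (finitely many negative powers) are elements of \<^typ>\<open>real fls\<close>;
  series in \<open>j\<close> with such coefficients are elements of \<^typ>\<open>real fls fps\<close>.
\<close>

subsection \<open>Factorial asymptotic expansions\<close>

definition factorial_expansion :: "real \<Rightarrow> real fls \<Rightarrow> real \<Rightarrow> (nat \<Rightarrow> real) \<Rightarrow> bool" where
  "factorial_expansion A f \<beta> c \<longleftrightarrow>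
     A > 0 \<and>
     (\<forall>R. (\<lambda>n. fls_nth f (int n)
               - (\<Sum>k<R. c k * A powr (- real n - \<beta> + real k) * Gamma (real n + \<beta> - real k)))
          \<in> O(\<lambda>n. A powr (- real n) * Gamma (real n + \<beta> - real R)))"

definition has_factorial_expansion :: "real \<Rightarrow> real fls \<Rightarrow> bool" where
  "has_factorial_expansion A f \<longleftrightarrow> (\<exists>\<beta> c. factorial_expansion A f \<beta> c)"

text \<open>
  The exponents in \<open>hbar^(-\<beta>) * (\<Sum>k. c k * hbar^k)\<close> are real numbers. The following
  two functions give the coefficient of \<open>hbar^x\<close>, for real \<open>x\<close>, in this series and in
  a Laurent series. The sum below has at most one term.
\<close>

definition shifted_series_coeff :: "real \<Rightarrow> (nat \<Rightarrow> real) \<Rightarrow> real \<Rightarrow> real" where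
  "shifted_series_coeff \<beta> c x = (\<Sum>k | real k - \<beta> = x. c k)"

definition fls_real_coeff :: "real fls \<Rightarrow> real \<Rightarrow> real" where
  "fls_real_coeff g x = (if x \<in> \<int> then fls_nth g \<lfloor>x\<rfloor> else 0)"

text \<open>
  The asymptotic operator. The pair \<open>(\<beta>, c)\<close> is not unique (\<open>\<beta>\<close> may be replaced by
  \<open>\<beta> + 1\<close> if \<open>c\<close> is shifted), but the series \<open>hbar^(-\<beta>) * (\<Sum>k. c k * hbar^k)\<close> is.
  Its value is recorded as a Laurent series, so the operator is unspecified where
  that series has a nonzero coefficient at a non-integral exponent, or where there is
  no expansion.
\<close>

definition asymp_op :: "real \<Rightarrow> real fls \<Rightarrow> real fls" where
  "asymp_op A f =
     (THE g. \<exists>\<beta> c. factorial_expansion A f \<beta> c \<and> fls_real_coeff g = shifted_series_coeff \<beta> c)"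

definition asymp_op_coeffwise :: "real \<Rightarrow> real fls fps \<Rightarrow> real fls fps" where
  "asymp_op_coeffwise A F = Abs_fps (\<lambda>m. asymp_op A (fps_nth F m))"


subsection \<open>Zero-dimensional cubic theory\<close>

definition fps_log :: "real fps \<Rightarrow> real fps" where
  "fps_log f = fps_compose (fps_ln 1) (f - 1)"  \<comment> \<open>meant for \<open>f\<close> with constant term 1\<close>

text \<open>The product is \<open>(6n - 1)!! = 1 * 3 * ... * (6n - 1)\<close>, with \<open>(-1)!! = 1\<close>.\<close>

definition Z0 :: "real fps" where
  "Z0 = Abs_fps (\<lambda>n. (\<Prod>i<3*n. real (2*i + 1)) / (fact 3 ^ (2*n) * fact (2*n)))"

definition one_minus_2j_powr :: "real \<Rightarrow> real fps" where  \<comment> \<open>\<open>(1 - 2j)^a\<close>\<close>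
  "one_minus_2j_powr a = fps_compose (fps_binomial a) (- fps_const 2 * fps_X)"

definition const_coeffs :: "real fps \<Rightarrow> real fls fps" where
  "const_coeffs F = Abs_fps (\<lambda>m. fls_const (fps_nth F m))"

text \<open>
  The substitution \<open>hbar := hbar / (1 - 2j)^(3/2)\<close>, sending \<open>\<Sum>n. f n * hbar^n\<close> to
  \<open>\<Sum>n. f n * hbar^n * (1 - 2j)^(-3n/2)\<close>, re-expanded in powers of \<open>j\<close>.
\<close>

definition subst_hbar :: "real fls \<Rightarrow> real fls fps" where
  "subst_hbar f = Abs_fps (\<lambda>m. Abs_fls (\<lambda>n.
     fls_nth f n * fps_nth (one_minus_2j_powr (- (3 / 2) * of_int n)) m))"

lemma subst_hbar_nth:
  "fls_nth (fps_nth (subst_hbar f) m) n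
     = fls_nth f n * fps_nth (one_minus_2j_powr (- (3 / 2) * of_int n)) m"
  unfolding subst_hbar_def fps_nth_Abs_fps
  by (rule nth_Abs_fls_lower_bound[where N = "fls_subdegree f"]) auto

definition W :: "real fls fps" where
  "W = fps_const (fls_const (1/3)) * const_coeffs (one_minus_2j_powr (3/2) - 1 + fps_const 3 * fps_X)
     + fps_const (fls_const (1/4) * fls_X) * const_coeffs (fps_log (1 / (1 - fps_const 2 * fps_X)))
     + fps_const fls_X * subst_hbar (fps_to_fls (fps_log Z0))"

end

theory Submission
  imports Defs "HOL-Real_Asymp.Real_Asymp"
begin

text \<open>
  Write \<open>f ~ g\<close> if the coefficients of \<open>f\<close> have the asymptotic expansion with coefficients read off
  the Laurent series \<open>g\<close>. Since \<open>Gamma (n - k + 1) = (n - k) * Gamma (n - k)\<close>, \<open>f ~ g\<close> implies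
  \<open>theta f ~ theta g + (A / hbar) * g\<close> for \<open>theta = hbar * d/dhbar\<close>; this is the source of the
  exponential prefactor: the coefficient of \<open>j^m\<close> in the substituted series is a polynomial in
  \<open>theta\<close> applied to \<open>log Z0\<close>, and both it and the right-hand side of the theorem satisfy the
  recurrence in \<open>m\<close> which comes from \<open>(1 - 2j) d/dj = 3 theta\<close>.

  The coefficients of \<open>Z0\<close> satisfy a first-order recurrence, which the truncated expansion solves
  up to one small term, and the leading constant is \<open>1 / (Gamma (1/6) * Gamma (5/6))\<close>. Finally,
  in a product of factorially divergent series only the terms at both ends of the convolution
  matter, so that \<open>log f ~ g / f\<close> for \<open>f ~ g\<close>.
\<close>

section \<open>Factorial weights\<close>

text \<open>The weight with which a term \<open>hbar^k\<close> of the asymptotic series enters the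
  coefficient of \<open>hbar^n\<close>. Since \<open>k\<close> runs over all integers, an integral
  shift \<open>\<beta>\<close> is absorbed into the index.\<close>

definition gamma_weight :: "real \<Rightarrow> int \<Rightarrow> nat \<Rightarrow> real" where
  "gamma_weight A k n = A powr (of_int k - real n) * Gamma (real n - of_int k)"

lemma gamma_weight_pos: "A > 0 \<Longrightarrow> int n > k \<Longrightarrow> gamma_weight A k n > 0"
  by (simp add: gamma_weight_def Gamma_real_pos)

lemma gamma_weight_Suc: "gamma_weight A (k + 1) (Suc n) = gamma_weight A k n"
  by (simp add: gamma_weight_def)

text \<open>Functional equation of \<open>Gamma\<close>. Writing \<open>w_k\<close> for the weights
  and reading it as \<open>n * w_k = k * w_k + A * w_(k-1)\<close>, it describes the effect of theta
  on them.\<close>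

lemma gamma_weight_pred:
  assumes "A > 0" "int n > k"
  shows "A * gamma_weight A (k - 1) n = (real n - of_int k) * gamma_weight A k n"
proof -
  have "Gamma (real n - of_int k + 1) = (real n - of_int k) * Gamma (real n - of_int k)"
    using assms by (intro Gamma_plus1) (auto elim!: nonpos_Ints_cases)
  then have G: "Gamma (real n - of_int (k - 1)) = (real n - of_int k) * Gamma (real n - of_int k)"
    by (simp add: algebra_simps)
  have P: "A powr (of_int k - real n) = A * A powr (of_int (k - 1) - real n)"
    using assms by (simp add: powr_diff)
  show ?thesis
    unfolding gamma_weight_def G P by simp
qed

lemma gamma_weight_of_nat:
  assumes "A > 0" "n > K"
  shows "gamma_weight A (int K) n = A ^ K / A ^ n * fact (n - K - 1)"
proof -
  have "real n - real K = 1 + real (n - K - 1)"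
    using assms by (simp add: of_nat_diff)
  then have "Gamma (real n - real K) = fact (n - K - 1)"
    using Gamma_fact[of "n - K - 1", where 'a = real] by (simp only:)
  then show ?thesis
    using assms by (simp add: gamma_weight_def powr_diff powr_realpow)
qed

lemma eventually_gt_int: "eventually (\<lambda>n. int n > k) sequentially"
  using eventually_gt_at_top[of "nat k"] by eventually_elim linarith

text \<open>The quotient of the weights for \<open>i + 1\<close> and \<open>i\<close> is
  \<open>A / (n - i - 1)\<close>, which tends to 0. Hence the weights form an asymptotic scale, with
  larger exponents of lower order.\<close>

lemma gamma_weight_smallo:
  assumes "A > 0" "k < l"
  shows "gamma_weight A l \<in> o(gamma_weight A k)"
  using assms(2)
proof (induction l rule: int_gr_induct)
  have step: "gamma_weight A (i + 1) \<in> o(gamma_weight A i)" for i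
  proof -
    have lim: "(\<lambda>n. A / (real n - of_int (i + 1))) \<longlonglongrightarrow> 0"
      by real_asymp
    have quot: "eventually (\<lambda>n. gamma_weight A (i + 1) n / gamma_weight A i n
                      = A / (real n - of_int (i + 1))) sequentially"
      using eventually_gt_int[of "i + 1"]
    proof eventually_elim
      case (elim n)
      then show ?case
        using gamma_weight_pred[of A "i + 1" n] gamma_weight_pos[of A i n] assms(1)
        by (simp add: field_simps)
    qed
    have "eventually (\<lambda>n. gamma_weight A i n \<noteq> 0) sequentially"
      using eventually_gt_int[of i]
      by eventually_elim (use gamma_weight_pos[OF assms(1)] in force)
    then show ?thesis
      using lim by (intro smalloI_tendsto) (subst tendsto_cong[OF quot])
  qed
  case base
  show ?case
    by (rule step)
  fix i
  assume "gamma_weight A i \<in> o(gamma_weight A k)"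
  with step show "gamma_weight A (i + 1) \<in> o(gamma_weight A k)"
    using landau_o.small.trans by blast
qed

lemma gamma_weight_bigo:
  assumes "A > 0" "k \<le> l"
  shows "gamma_weight A l \<in> O(gamma_weight A k)"
proof (cases "k = l")
  case False
  then show ?thesis
    using assms by (intro landau_o.small_imp_big gamma_weight_smallo) auto
qed auto

lemma bigo_gamma_weight_mono:
  "A > 0 \<Longrightarrow> k \<le> l \<Longrightarrow> f \<in> O(gamma_weight A l) \<Longrightarrow> f \<in> O(gamma_weight A k)"
  using gamma_weight_bigo landau_o.big.trans by blast

section \<open>Orders of coefficients under multiplication by hbar and under theta\<close>

lemma eventually_zero_bigo:
  fixes f g :: "nat \<Rightarrow> real"
  shows "eventually (\<lambda>n. f n = 0) sequentially \<Longrightarrow> f \<in> O(g)"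
  by (intro bigoI[where c = 0]) (auto elim!: eventually_mono)

lemma bigo_Suc_iff:
  fixes f g :: "nat \<Rightarrow> real"
  shows "(\<lambda>n. f (Suc n)) \<in> O(\<lambda>n. g (Suc n)) \<longleftrightarrow> f \<in> O(g)"
proof -
  have "eventually (\<lambda>n. norm (f (Suc n)) \<le> c * norm (g (Suc n))) sequentially
        \<longleftrightarrow> eventually (\<lambda>n. norm (f n) \<le> c * norm (g n)) sequentially" for c
    by (rule eventually_sequentially_Suc)
  then show ?thesis
    by (simp add: bigo_def)
qed

lemma fps_nth_add_eq: "fps_nth (f + g) = (\<lambda>n. fps_nth f n + fps_nth g n)"
  and fps_nth_diff_eq: "fps_nth (f - g) = (\<lambda>n. fps_nth f n - fps_nth g n)"
  by auto

lemma fps_X_mult_bigo_iff: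
  "fps_nth (fps_X * f) \<in> O(gamma_weight A k) \<longleftrightarrow> fps_nth f \<in> O(gamma_weight A (k - 1))"
proof -
  have "fps_nth (fps_X * f) \<in> O(gamma_weight A k)
        \<longleftrightarrow> (\<lambda>n. fps_nth (fps_X * f) (Suc n)) \<in> O(\<lambda>n. gamma_weight A k (Suc n))"
    by (rule bigo_Suc_iff[symmetric])
  also have "\<dots> \<longleftrightarrow> fps_nth f \<in> O(gamma_weight A (k - 1))"
    using gamma_weight_Suc[of A "k - 1"] by simp
  finally show ?thesis .
qed

text \<open>Multiplication by \<open>n\<close> costs exactly one order, because
  \<open>(n - k) / A\<close> and \<open>n\<close> are of the same size. As an equivalence it also
  carries a bound on theta f back to a bound on \<open>f\<close>.\<close>

lemma real_mult_bigo_iff: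
  assumes "A > 0"
  shows "(\<lambda>n. real n * f n) \<in> O(gamma_weight A (k - 1)) \<longleftrightarrow> f \<in> O(gamma_weight A k)"
proof -
  have "gamma_weight A (k - 1) \<in> \<Theta>(\<lambda>n. (real n - of_int k) / A * gamma_weight A k n)"
  proof (intro bigthetaI_cong)
    show "eventually (\<lambda>n. gamma_weight A (k - 1) n = (real n - of_int k) / A * gamma_weight A k n) sequentially"
      using eventually_gt_int[of k]
      by eventually_elim (use gamma_weight_pred[of A k] assms in \<open>simp add: field_simps\<close>)
  qed
  also have "(\<lambda>n. (real n - of_int k) / A * gamma_weight A k n) \<in> \<Theta>(\<lambda>n. real n * gamma_weight A k n)"
  proof (intro landau_theta.mult_right)
    show "(\<lambda>n. (real n - of_int k) / A) \<in> \<Theta>(\<lambda>n. real n)"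
      using assms by real_asymp
  qed
  finally have "O(gamma_weight A (k - 1)) = O(\<lambda>n. real n * gamma_weight A k n)"
    by (rule landau_o.big.cong_bigtheta)
  moreover have "eventually (\<lambda>n. real n \<noteq> 0) sequentially"
    using eventually_gt_at_top[of 0] by eventually_elim auto
  ultimately show ?thesis
    by (simp add: landau_o.big.mult_cancel_left)
qed

lemma fps_theta_nth: "fps_nth (fps_X * fps_deriv f) n = of_nat n * fps_nth f n"
  by (cases n) auto

lemma fps_theta_bigo_iff:
  assumes "A > 0"
  shows "fps_nth (fps_X * fps_deriv f) \<in> O(gamma_weight A (k - 1)) \<longleftrightarrow> fps_nth f \<in> O(gamma_weight A k)"
  using real_mult_bigo_iff[OF assms, of "fps_nth f" k]
  by (simp add: fps_theta_nth[abs_def])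

section \<open>Products and inverses of factorially divergent series\<close>

lemma finite_fps_eq_sum:
  fixes q :: "'a :: comm_ring_1 fps"
  assumes "\<And>n. n \<ge> N \<Longrightarrow> fps_nth q n = 0"
  shows "q = (\<Sum>i<N. fps_const (fps_nth q i) * fps_X ^ i)"
proof (rule fps_ext)
  fix n
  have "fps_nth (\<Sum>i<N. fps_const (fps_nth q i) * fps_X ^ i) n = (\<Sum>i<N. if i = n then fps_nth q i else 0)"
    by (simp add: fps_sum_nth if_distrib[of "(*) _"] eq_commute[of n] cong: if_cong)
  also have "\<dots> = fps_nth q n"
    using assms[of n] by (cases "n < N") (auto simp: sum.delta not_less)
  finally show "fps_nth q n = fps_nth (\<Sum>i<N. fps_const (fps_nth q i) * fps_X ^ i) n" ..
qed

lemma finite_fps_mult: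
  fixes p q :: "'a :: comm_ring_1 fps"
  assumes "eventually (\<lambda>n. fps_nth p n = 0) sequentially" "eventually (\<lambda>n. fps_nth q n = 0) sequentially"
  shows "eventually (\<lambda>n. fps_nth (p * q) n = 0) sequentially"
proof -
  obtain M N where M: "\<And>n. n \<ge> M \<Longrightarrow> fps_nth p n = 0" and N: "\<And>n. n \<ge> N \<Longrightarrow> fps_nth q n = 0"
    using assms unfolding eventually_sequentially by blast
  have "fps_nth (p * q) n = 0" if "n \<ge> M + N" for n
    unfolding fps_mult_nth
  proof (intro sum.neutral ballI)
    fix i assume "i \<in> {0..n}"
    have "i \<ge> M \<or> n - i \<ge> N"
      using that by linarith
    then show "fps_nth p i * fps_nth q (n - i) = 0"
      using M N by auto
  qed
  then show ?thesis
    unfolding eventually_sequentially by blast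
qed

lemma finite_fps_cutoff: "eventually (\<lambda>n. fps_nth (fps_cutoff K f) n = 0) sequentially"
  using eventually_ge_at_top[of K] by eventually_elim auto

text \<open>Each factor \<open>fps_X ^ i\<close> gains \<open>i\<close> orders, and the terms of
  \<open>q\<close> that are present have \<open>i \<ge> M\<close>.\<close>

lemma finite_fps_mult_bigo:
  fixes q f :: "real fps"
  assumes A: "A > 0" and fin: "eventually (\<lambda>n. fps_nth q n = 0) sequentially"
    and low: "\<And>i. i < M \<Longrightarrow> fps_nth q i = 0" and f: "fps_nth f \<in> O(gamma_weight A k)"
  shows "fps_nth (q * f) \<in> O(gamma_weight A (k + int M))"
proof -
  obtain N where N: "\<And>n. n \<ge> N \<Longrightarrow> fps_nth q n = 0"
    using fin unfolding eventually_sequentially by blast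
  have pow: "fps_nth (fps_X ^ i * f) \<in> O(gamma_weight A (k + int i))" for i
  proof (induction i)
    case (Suc i)
    have "fps_nth (fps_X * (fps_X ^ i * f)) \<in> O(gamma_weight A (k + int (Suc i)))"
      unfolding fps_X_mult_bigo_iff using Suc by (simp add: algebra_simps)
    then show ?case
      by (simp add: mult.assoc del: fps_X_mult_nth)
  qed (use f in simp)
  have "fps_nth (q * f) n = (\<Sum>i<N. fps_nth q i * fps_nth (fps_X ^ i * f) n)" for n
    by (subst finite_fps_eq_sum[OF N]) (simp_all add: sum_distrib_right fps_sum_nth mult.assoc)
  moreover have "(\<lambda>n. \<Sum>i<N. fps_nth q i * fps_nth (fps_X ^ i * f) n) \<in> O(gamma_weight A (k + int M))"
  proof (intro big_sum_in_bigo)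
    fix i
    show "(\<lambda>n. fps_nth q i * fps_nth (fps_X ^ i * f) n) \<in> O(gamma_weight A (k + int M))"
    proof (cases "i < M")
      case False
      then have "fps_nth (fps_X ^ i * f) \<in> O(gamma_weight A (k + int M))"
        using bigo_gamma_weight_mono[OF A _ pow[of i]] by simp
      then show ?thesis
        by simp
    qed (use low in simp)
  qed
  ultimately show ?thesis
    by presburger
qed

section \<open>Log-convexity of the factorial and convolution sums\<close>

lemma fact_mult_fact_le:
  assumes "a \<le> j"
  shows "fact (a + d) * fact j \<le> (fact a * fact (j + d) :: real)"
proof (induction d)
  case (Suc d)
  have "fact (a + Suc d) * fact j = real (a + Suc d) * (fact (a + d) * fact j)"
    by simp
  also have "\<dots> \<le> real (j + Suc d) * (fact a * fact (j + d))"
    using assms by (intro mult_mono Suc) auto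
  finally show ?case
    by (simp add: algebra_simps)
qed simp

text \<open>The two end terms both equal \<open>fact (K - 1) * fact (n - K - 1)\<close>. By
  log-convexity each inner term is at most \<open>fact K * fact (n - K - 2)\<close>, and there are
  fewer than \<open>n - K\<close> of them.\<close>

lemma fact_convolution_le:
  assumes "K \<ge> 1" "2 * K \<le> n"
  shows "(\<Sum>i=K..n-K. fact (i - 1) * fact (n - i - 1)) \<le> (2 * fact (K - 1) + fact K) * (fact (n - K - 1) :: real)"
proof -
  let ?t = "\<lambda>i. fact (i - 1) * fact (n - i - 1) :: real"
  let ?I = "{K+1..n-K-1}"
  have "?t i \<le> fact K * fact (n - K - 2)" if "i \<in> ?I" for i
  proof -
    have "fact (K + (i - 1 - K)) * fact (n - i - 1) \<le> (fact K * fact (n - i - 1 + (i - 1 - K)) :: real)"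
      using that by (intro fact_mult_fact_le) auto
    moreover have "K + (i - 1 - K) = i - 1" "n - i - 1 + (i - 1 - K) = n - K - 2"
      using that by auto
    ultimately show ?thesis
      by simp
  qed
  then have "sum ?t ?I \<le> (\<Sum>i\<in>?I. fact K * fact (n - K - 2))"
    by (intro sum_mono)
  also have "\<dots> \<le> fact K * (real (n - 2 * K - 1) * fact (n - K - 2))"
    by simp
  also have "\<dots> \<le> fact K * fact (n - K - 1)"
  proof (cases "n \<ge> 2 * K + 2")
    case True
    then have "fact (n - K - 1) = (real (n - K - 1) * fact (n - K - 2) :: real)"
      using fact_reduce[of "n - K - 1", where 'a = real] assms by (simp add: numeral_2_eq_2)
    then show ?thesis
      using assms by (auto intro!: mult_left_mono mult_right_mono)
  qed auto
  finally have inner: "sum ?t ?I \<le> fact K * fact (n - K - 1)" .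
  have "sum ?t {K..n-K} \<le> sum ?t (insert K (insert (n - K) ?I))"
    by (intro sum_mono2) auto
  \<comment> \<open>An inequality, because the two ends coincide when
    \<open>n = 2 * K\<close>.\<close>
  also have "\<dots> \<le> ?t K + (?t (n - K) + sum ?t ?I)"
    using assms by (simp add: sum.insert_if)
  also have "?t (n - K) = ?t K"
    using assms by simp
  finally show ?thesis
    using inner by (simp add: algebra_simps)
qed

text \<open>The finitely many exceptional indices are absorbed by enlarging the constant. The bound
  uses \<open>fact (n - 1) / A ^ n\<close> because the weight itself is 0 at \<open>n = 0\<close>,
  whereas truncated subtraction keeps this expression positive there.\<close>

lemma bigo_gamma_weight_0_bound:
  assumes "A > 0" "f \<in> O(gamma_weight A 0)"
  obtains C where "C > 0" "\<And>n. \<bar>f n\<bar> \<le> C * (fact (n - 1) / A ^ n)"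
proof -
  obtain c N where c: "\<And>n. n \<ge> N \<Longrightarrow> \<bar>f n\<bar> \<le> c * \<bar>gamma_weight A 0 n\<bar>"
    using assms(2) unfolding bigo_def eventually_sequentially by auto
  define w where "w n = fact (n - 1) / A ^ n" for n
  have w: "w n > 0" for n
    using assms(1) by (simp add: w_def)
  define C where "C = Max (insert 1 (insert c ((\<lambda>n. \<bar>f n\<bar> / w n) ` {..N})))"
  have C: "C \<ge> 1" "C \<ge> c" and fC: "n \<le> N \<Longrightarrow> \<bar>f n\<bar> / w n \<le> C" for n
    unfolding C_def by (intro Max_ge; simp)+
  have "\<bar>f n\<bar> \<le> C * w n" for n
  proof (cases "n \<le> N")
    case True
    then show ?thesis
      using fC[of n] w[of n] by (simp add: field_simps)
  next
    case False
    then have "gamma_weight A 0 n = w n"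
      using gamma_weight_of_nat[of A 0 n] assms(1) by (simp add: w_def)
    then have "\<bar>f n\<bar> \<le> c * w n"
      using c[of n] False w[of n] by simp
    also have "\<dots> \<le> C * w n"
      using C w[of n] by (intro mult_right_mono) auto
    finally show ?thesis .
  qed
  then show ?thesis
    using that[of C] C(1) by (simp add: w_def)
qed

text \<open>The convolution consists of a lower end, an upper end and the middle
  \<open>K \<le> i \<le> n - K\<close>. The two cutoff products remove the ends, and
  \<open>fact_convolution_le\<close> bounds the middle.\<close>

lemma fps_mult_bigo_cutoff:
  fixes f h :: "real fps"
  assumes A: "A > 0" and K: "K \<ge> 1"
    and f: "fps_nth f \<in> O(gamma_weight A 0)" and h: "fps_nth h \<in> O(gamma_weight A 0)"
  shows "fps_nth (f * h - (fps_cutoff K h * f + fps_cutoff K f * h)) \<in> O(gamma_weight A (int K))"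
proof -
  obtain C D where C: "C > 0" "\<And>n. \<bar>fps_nth f n\<bar> \<le> C * (fact (n - 1) / A ^ n)"
    and D: "D > 0" "\<And>n. \<bar>fps_nth h n\<bar> \<le> D * (fact (n - 1) / A ^ n)"
    using bigo_gamma_weight_0_bound[OF A f] bigo_gamma_weight_0_bound[OF A h] by metis
  define B where "B = 2 * fact (K - 1) + (fact K :: real)"
  show ?thesis
  proof (rule bigoI)
    show "eventually (\<lambda>n. norm (fps_nth (f * h - (fps_cutoff K h * f + fps_cutoff K f * h)) n)
            \<le> (C * D * B / A ^ K) * norm (gamma_weight A (int K) n)) sequentially"
      using eventually_ge_at_top[of "2 * K"]
    proof eventually_elim
      case (elim n)
      have "fps_nth (f * h - (fps_cutoff K h * f + fps_cutoff K f * h)) n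
            = fps_nth (f * h - (f * fps_cutoff K h + fps_cutoff K f * h)) n"
        by (simp add: mult.commute)
      also have "\<dots> = (\<Sum>i=0..n. fps_nth f i * fps_nth h (n - i)
              - (fps_nth f i * fps_nth (fps_cutoff K h) (n - i) + fps_nth (fps_cutoff K f) i * fps_nth h (n - i)))"
        by (simp add: fps_mult_nth sum_subtractf sum.distrib)
      \<comment> \<open>For \<open>2 * K \<le> n\<close> the conditions \<open>i < K\<close> and
        \<open>n - i < K\<close> exclude each other, so no end term is subtracted twice.\<close>
      also have "\<dots> = (\<Sum>i=0..n. if i \<in> {K..n-K} then fps_nth f i * fps_nth h (n - i) else 0)"
        using elim by (intro sum.cong) auto
      also have "\<dots> = (\<Sum>i\<in>{0..n} \<inter> {K..n-K}. fps_nth f i * fps_nth h (n - i))"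
        by (subst sum.inter_restrict) auto
      also have "{0..n} \<inter> {K..n-K} = {K..n-K}"
        by auto
      finally have eq: "fps_nth (f * h - (fps_cutoff K h * f + fps_cutoff K f * h)) n
          = (\<Sum>i=K..n-K. fps_nth f i * fps_nth h (n - i))" .
      have "\<bar>\<Sum>i=K..n-K. fps_nth f i * fps_nth h (n - i)\<bar> \<le> (\<Sum>i=K..n-K. \<bar>fps_nth f i\<bar> * \<bar>fps_nth h (n - i)\<bar>)"
        by (rule order.trans[OF sum_abs]) (simp add: abs_mult)
      also have "\<dots> \<le> (\<Sum>i=K..n-K. (C * (fact (i - 1) / A ^ i)) * (D * (fact (n - i - 1) / A ^ (n - i))))"
        using C(1) D(1) A by (intro sum_mono mult_mono C(2) D(2)) auto
      also have "\<dots> = C * D / A ^ n * (\<Sum>i=K..n-K. fact (i - 1) * fact (n - i - 1))"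
        unfolding sum_distrib_left
      proof (intro sum.cong refl)
        fix i assume "i \<in> {K..n-K}"
        then have "A ^ n = A ^ i * A ^ (n - i)"
          using elim by (auto simp flip: power_add intro!: arg_cong[of _ _ "power A"])
        then show "(C * (fact (i - 1) / A ^ i)) * (D * (fact (n - i - 1) / A ^ (n - i)))
              = C * D / A ^ n * (fact (i - 1) * fact (n - i - 1))"
          by simp
      qed
      also have "\<dots> \<le> C * D / A ^ n * (B * fact (n - K - 1))"
        unfolding B_def using A C D K elim by (intro mult_left_mono fact_convolution_le) auto
      also have "\<dots> = (C * D * B / A ^ K) * gamma_weight A (int K) n"
        using A K elim by (subst gamma_weight_of_nat) auto
      finally show ?case
        unfolding eq using gamma_weight_pos[of A "int K" n] A K elim by simp
    qed
  qed
qed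

text \<open>Strong induction, with \<open>fps_nth (f * h) n = 0\<close> solved for
  \<open>fps_nth h n\<close>. Half of the permitted bound goes to the term
  \<open>fps_nth f n * fps_nth h 0\<close>, the other half to the inner convolution terms, whose sum
  gains a factor of order \<open>1 / n\<close>.\<close>

lemma fps_inverse_bigo:
  fixes f h :: "real fps"
  assumes A: "A > 0" and f: "fps_nth f \<in> O(gamma_weight A 0)" and fh: "f * h = 1"
  shows "fps_nth h \<in> O(gamma_weight A 0)"
proof -
  obtain C where C: "C > 0" "\<And>n. \<bar>fps_nth f n\<bar> \<le> C * (fact (n - 1) / A ^ n)"
    using bigo_gamma_weight_0_bound[OF A f] by metis
  define w where "w n = fact (n - 1) / A ^ n" for n
  have w: "w n > 0" for n
    using A by (simp add: w_def)
  define f0 where "f0 = \<bar>fps_nth f 0\<bar>"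
  have f0: "f0 > 0"
    using fh unfolding f0_def by (metis fps_mult_nth_0 fps_one_nth mult_zero_left zero_less_abs_iff zero_neq_one)
  \<comment> \<open>Chosen so that \<open>3 * C / (n - 1) \<le> f0 / 2\<close> for all
    \<open>n > N\<close>, which is the share of the inner terms.\<close>
  obtain N :: nat where N: "real N \<ge> 6 * C / f0 + 2"
    using real_arch_simple by blast
  \<comment> \<open>The first entry fits the term with \<open>fps_nth h 0\<close> into its half; the
    others start the induction.\<close>
  define M where "M = Max (insert (2 * C * \<bar>fps_nth h 0\<bar> / f0) ((\<lambda>n. \<bar>fps_nth h n\<bar> / w n) ` {..N}))"
  have M0: "2 * C * \<bar>fps_nth h 0\<bar> / f0 \<le> M" and MN: "n \<le> N \<Longrightarrow> \<bar>fps_nth h n\<bar> / w n \<le> M" for n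
    unfolding M_def by (intro Max_ge; simp)+
  have M: "M \<ge> 0"
    using M0 C(1) f0 by (meson abs_ge_zero divide_nonneg_pos mult_nonneg_nonneg less_imp_le order.trans zero_le_numeral)
  have bound: "\<bar>fps_nth h n\<bar> \<le> M * w n" for n
  proof (induction n rule: less_induct)
    case (less n)
    show ?case
    proof (cases "n \<le> N")
      case True
      then show ?thesis
        using MN[of n] w[of n] by (simp add: field_simps)
    next
      case False
      have "6 * C / f0 \<ge> 0"
        using C f0 by simp
      then have n2: "n \<ge> 2" and n6: "real (n - 1) \<ge> 6 * C / f0"
        using False N by linarith+
      have split: "{0..n} = insert 0 (insert n {1..n-1})"
        using n2 by auto
      have "0 = fps_nth (f * h) n"
        using n2 fh by simp
      also have "\<dots> = fps_nth f 0 * fps_nth h n + (fps_nth f n * fps_nth h 0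
                        + (\<Sum>i=1..n-1. fps_nth f i * fps_nth h (n - i)))"
        unfolding fps_mult_nth split using n2 by (subst sum.insert; simp)+
      finally have eq: "fps_nth f 0 * fps_nth h n = - (fps_nth f n * fps_nth h 0
                        + (\<Sum>i=1..n-1. fps_nth f i * fps_nth h (n - i)))"
        by linarith
      have IH: "\<bar>fps_nth h (n - i)\<bar> \<le> M * (fact (n - i - 1) / A ^ (n - i))" if "i \<in> {1..n-1}" for i
        using less[of "n - i"] that unfolding w_def by auto
      have "\<bar>\<Sum>i=1..n-1. fps_nth f i * fps_nth h (n - i)\<bar> \<le> (\<Sum>i=1..n-1. \<bar>fps_nth f i\<bar> * \<bar>fps_nth h (n - i)\<bar>)"
        by (rule order.trans[OF sum_abs]) (simp add: abs_mult)
      also have "\<dots> \<le> (\<Sum>i=1..n-1. (C * (fact (i - 1) / A ^ i)) * (M * (fact (n - i - 1) / A ^ (n - i))))"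
        using C(1) M A by (intro sum_mono mult_mono C(2) IH) auto
      also have "\<dots> = C * M / A ^ n * (\<Sum>i=1..n-1. fact (i - 1) * fact (n - i - 1))"
        unfolding sum_distrib_left
      proof (intro sum.cong refl)
        fix i assume "i \<in> {1..n-1}"
        then have "A ^ n = A ^ i * A ^ (n - i)"
          by (auto simp flip: power_add intro!: arg_cong[of _ _ "power A"])
        then show "(C * (fact (i - 1) / A ^ i)) * (M * (fact (n - i - 1) / A ^ (n - i)))
              = C * M / A ^ n * (fact (i - 1) * fact (n - i - 1))"
          by simp
      qed
      also have "\<dots> \<le> C * M / A ^ n * (3 * fact (n - 2))"
        using A C M fact_convolution_le[of 1 n] n2 by (intro mult_left_mono) (auto simp: numeral_2_eq_2)
      also have "\<dots> = (3 * C / real (n - 1)) * (M * w n)"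
      proof -
        define r where "r = real (n - 1)"
        have "fact (n - 1) = r * fact (n - 2)" "r \<noteq> 0"
          using fact_reduce[of "n - 1", where 'a = real] n2 by (simp_all add: r_def numeral_2_eq_2)
        then show ?thesis
          unfolding w_def r_def[symmetric] by simp
      qed
      also have "\<dots> \<le> (f0 / 2) * (M * w n)"
        using n6 n2 f0 C M w[of n] by (intro mult_right_mono) (auto simp: field_simps)
      finally have "\<bar>\<Sum>i=1..n-1. fps_nth f i * fps_nth h (n - i)\<bar> \<le> (f0 / 2) * (M * w n)" .
      moreover have "\<bar>fps_nth f n * fps_nth h 0\<bar> \<le> (f0 / 2) * (M * w n)"
      proof -
        have "\<bar>fps_nth f n * fps_nth h 0\<bar> \<le> C * w n * \<bar>fps_nth h 0\<bar>"
          unfolding abs_mult w_def using C(2)[of n] by (intro mult_right_mono) auto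
        also have "\<dots> = (f0 / 2) * ((2 * C * \<bar>fps_nth h 0\<bar> / f0) * w n)"
          using f0 by simp
        also have "\<dots> \<le> (f0 / 2) * (M * w n)"
          using M0 f0 w[of n] by (intro mult_left_mono mult_right_mono) auto
        finally show ?thesis .
      qed
      ultimately have "\<bar>fps_nth f 0 * fps_nth h n\<bar> \<le> f0 * (M * w n)"
        unfolding eq by linarith
      then show ?thesis
        using f0 by (simp add: abs_mult f0_def)
    qed
  qed
  show ?thesis
  proof (rule bigoI)
    show "eventually (\<lambda>n. norm (fps_nth h n) \<le> M * norm (gamma_weight A 0 n)) sequentially"
      using eventually_gt_at_top[of 0]
      by eventually_elim
         (use bound A gamma_weight_pos[of A 0] gamma_weight_of_nat[of A 0] in \<open>simp add: w_def\<close>)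
  qed
qed

section \<open>Laurent series as factorial asymptotic expansions\<close>

text \<open>Stated for coefficient functions, so that power series and the nonnegative part of a
  Laurent series are treated alike. Any lower bound \<open>N\<close> of the support of
  \<open>g\<close> gives the same sums, by \<open>laurent_sum_lower\<close>.\<close>

definition laurent_expansion :: "real \<Rightarrow> (nat \<Rightarrow> real) \<Rightarrow> real fls \<Rightarrow> bool" where
  "laurent_expansion A f g \<longleftrightarrow>
     (\<exists>N. (\<forall>k<N. fls_nth g k = 0) \<and>
          (\<forall>K. (\<lambda>n. f n - (\<Sum>k\<in>{N..<K}. fls_nth g k * gamma_weight A k n)) \<in> O(gamma_weight A K)))"

lemma laurent_sum_lower:
  assumes "\<And>k. k < N \<Longrightarrow> fls_nth g k = 0" "\<And>k. k < M \<Longrightarrow> fls_nth g k = 0"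
  shows "(\<Sum>k\<in>{N..<K}. fls_nth g k * w k) = (\<Sum>k\<in>{M..<K}. fls_nth g k * (w k :: real))"
proof -
  have *: "(\<Sum>k\<in>{N..<K}. fls_nth g k * w k) = (\<Sum>k\<in>{max N M..<K}. fls_nth g k * w k)"
    if "\<And>k. k < M \<Longrightarrow> fls_nth g k = 0" for N M
    using that by (intro sum.mono_neutral_right) auto
  show ?thesis
    using *[of M N] *[of N M] assms by (simp add: max.commute)
qed

lemma laurent_expansionD:
  assumes "laurent_expansion A f g" "\<And>k. k < N \<Longrightarrow> fls_nth g k = 0"
  shows "(\<lambda>n. f n - (\<Sum>k\<in>{N..<K}. fls_nth g k * gamma_weight A k n)) \<in> O(gamma_weight A K)"
proof -
  obtain M where M: "\<And>k. k < M \<Longrightarrow> fls_nth g k = 0"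
    "(\<lambda>n. f n - (\<Sum>k\<in>{M..<K}. fls_nth g k * gamma_weight A k n)) \<in> O(gamma_weight A K)"
    using assms(1) unfolding laurent_expansion_def by blast
  show ?thesis
    using M(2) by (subst laurent_sum_lower[OF assms(2) M(1)])
qed

text \<open>Large \<open>K\<close> suffice: passing to a smaller \<open>K\<close> moves finitely
  many terms into the error, and each of them is within the coarser bound.\<close>

lemma laurent_expansionI:
  assumes A: "A > 0" and low: "\<And>k. k < N \<Longrightarrow> fls_nth g k = 0"
    and approx: "\<And>K. K \<ge> K0 \<Longrightarrow>
      (\<lambda>n. f n - (\<Sum>k\<in>{N..<K}. fls_nth g k * gamma_weight A k n)) \<in> O(gamma_weight A K)"
  shows "laurent_expansion A f g"
  unfolding laurent_expansion_def
proof (intro exI[of _ N] conjI allI impI low)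
  fix K
  let ?L = "max K (max N K0)"
  have "(\<lambda>n. (f n - (\<Sum>k\<in>{N..<?L}. fls_nth g k * gamma_weight A k n))
          + (\<Sum>k\<in>{max N K..<?L}. fls_nth g k * gamma_weight A k n)) \<in> O(gamma_weight A K)"
  proof (intro sum_in_bigo(1) big_sum_in_bigo)
    show "(\<lambda>n. f n - (\<Sum>k\<in>{N..<?L}. fls_nth g k * gamma_weight A k n)) \<in> O(gamma_weight A K)"
      by (rule bigo_gamma_weight_mono[OF A _ approx]) auto
    fix k assume "k \<in> {max N K..<?L}"
    then show "(\<lambda>n. fls_nth g k * gamma_weight A k n) \<in> O(gamma_weight A K)"
      using gamma_weight_bigo[OF A, of K k] by simp
  qed
  moreover have "(\<Sum>k\<in>{N..<?L}. fls_nth g k * gamma_weight A k n)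
        = (\<Sum>k\<in>{N..<K}. fls_nth g k * gamma_weight A k n) + (\<Sum>k\<in>{max N K..<?L}. fls_nth g k * gamma_weight A k n)" for n
    by (subst sum.union_disjoint[symmetric]) (auto intro!: sum.cong)
  ultimately show "(\<lambda>n. f n - (\<Sum>k\<in>{N..<K}. fls_nth g k * gamma_weight A k n)) \<in> O(gamma_weight A K)"
    by simp
qed

lemma fls_lower_bound: obtains N where "\<And>k. k < N \<Longrightarrow> fls_nth g k = 0"
  using fls_eq0_below_subdegree by blast

text \<open>Allows a comparison function that changes with the order \<open>K\<close>, as is needed
  for the logarithm, where a cutoff at \<open>K\<close> enters.\<close>

lemma laurent_expansion_approx:
  assumes A: "A > 0"
    and approx: "\<And>K. K \<ge> K0 \<Longrightarrow> \<exists>f' g'. (\<lambda>n. f n - f' n) \<in> O(gamma_weight A K) \<and>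
                   laurent_expansion A f' g' \<and> (\<forall>k<K. fls_nth g k = fls_nth g' k)"
  shows "laurent_expansion A f g"
proof -
  obtain N where N: "\<And>k. k < N \<Longrightarrow> fls_nth g k = 0"
    using fls_lower_bound[of g] by metis
  show ?thesis
  proof (rule laurent_expansionI[OF A N, where ?K0.0 = "max K0 N"])
    fix K assume K: "K \<ge> max K0 N"
    then obtain f' g' where f': "(\<lambda>n. f n - f' n) \<in> O(gamma_weight A K)"
      and g': "laurent_expansion A f' g'" "\<And>k. k < K \<Longrightarrow> fls_nth g k = fls_nth g' k"
      using approx[of K] by auto
    have "(\<lambda>n. f' n - (\<Sum>k\<in>{N..<K}. fls_nth g' k * gamma_weight A k n)) \<in> O(gamma_weight A K)"
      using g'(2) N K by (intro laurent_expansionD[OF g'(1)]) (metis less_le_trans max.cobounded2)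
    moreover have "(\<Sum>k\<in>{N..<K}. fls_nth g' k * gamma_weight A k n)
          = (\<Sum>k\<in>{N..<K}. fls_nth g k * gamma_weight A k n)" for n
      using g'(2) by (intro sum.cong) auto
    ultimately have "(\<lambda>n. f' n - (\<Sum>k\<in>{N..<K}. fls_nth g k * gamma_weight A k n)) \<in> O(gamma_weight A K)"
      by simp
    from sum_in_bigo(1)[OF f' this]
    show "(\<lambda>n. f n - (\<Sum>k\<in>{N..<K}. fls_nth g k * gamma_weight A k n)) \<in> O(gamma_weight A K)"
      by simp
  qed
qed

section \<open>Closure properties and uniqueness of expansions\<close>

lemma laurent_expansion_zero:
  assumes "A > 0" "eventually (\<lambda>n. f n = 0) sequentially"
  shows "laurent_expansion A f 0"
  using assms by (intro laurent_expansionI[where N = 0]) (auto intro: eventually_zero_bigo)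

lemma laurent_expansion_add:
  assumes A: "A > 0" and "laurent_expansion A f g" "laurent_expansion A f' g'"
  shows "laurent_expansion A (\<lambda>n. f n + f' n) (g + g')"
proof -
  define N where "N = min (fls_subdegree g) (fls_subdegree g')"
  have N: "k < N \<Longrightarrow> fls_nth g k = 0" "k < N \<Longrightarrow> fls_nth g' k = 0" for k
    by (auto simp: N_def)
  show ?thesis
  proof (rule laurent_expansionI[OF A, of N])
    fix K
    show "(\<lambda>n. (f n + f' n) - (\<Sum>k\<in>{N..<K}. fls_nth (g + g') k * gamma_weight A k n)) \<in> O(gamma_weight A K)"
      using sum_in_bigo(1)[OF laurent_expansionD[OF assms(2) N(1), of N K] laurent_expansionD[OF assms(3) N(2), of N K]]
      by (simp add: algebra_simps sum.distrib)
  qed (use N in auto)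
qed

lemma laurent_expansion_cmult:
  assumes A: "A > 0" and "laurent_expansion A f g"
  shows "laurent_expansion A (\<lambda>n. c * f n) (fls_const c * g)"
proof -
  obtain N where N: "\<And>k. k < N \<Longrightarrow> fls_nth g k = 0"
    using fls_lower_bound[of g] by metis
  show ?thesis
  proof (rule laurent_expansionI[OF A, of N])
    fix K
    have "(\<lambda>n. c * (f n - (\<Sum>k\<in>{N..<K}. fls_nth g k * gamma_weight A k n))) \<in> O(gamma_weight A K)"
      using laurent_expansionD[OF assms(2) N, of N K] by (cases "c = 0") simp_all
    then show "(\<lambda>n. c * f n - (\<Sum>k\<in>{N..<K}. fls_nth (fls_const c * g) k * gamma_weight A k n)) \<in> O(gamma_weight A K)"
      by (simp add: right_diff_distrib sum_distrib_left mult.assoc)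
  qed (use N in auto)
qed

lemma laurent_expansion_diff:
  assumes A: "A > 0" and "laurent_expansion A f g" "laurent_expansion A f' g'"
  shows "laurent_expansion A (\<lambda>n. f n - f' n) (g - g')"
proof -
  have "fls_const (- 1) * g' = - g'"
    by (simp add: fls_eq_iff)
  then show ?thesis
    using laurent_expansion_add[OF A assms(2) laurent_expansion_cmult[OF A assms(3), of "- 1"]] by simp
qed

lemma laurent_expansion_sum:
  assumes A: "A > 0" and "\<And>i. i \<in> I \<Longrightarrow> laurent_expansion A (f i) (g i)"
  shows "laurent_expansion A (\<lambda>n. \<Sum>i\<in>I. f i n) (\<Sum>i\<in>I. g i)"
  using assms(2)
  by (induction I rule: infinite_finite_induct)
     (auto intro!: laurent_expansion_add[OF A] laurent_expansion_zero[OF A])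

text \<open>Multiplication by hbar. The hypothesis sees only the values \<open>f (Suc n)\<close>,
  which later makes the part of \<open>W\<close> of order \<open>hbar^0\<close> drop out.\<close>

lemma laurent_expansion_shift:
  assumes A: "A > 0" and f: "laurent_expansion A (\<lambda>n. f (Suc n)) g"
  shows "laurent_expansion A f (fls_X * g)"
proof -
  obtain N where N: "\<And>k. k < N \<Longrightarrow> fls_nth g k = 0"
    using fls_lower_bound[of g] by metis
  show ?thesis
  proof (rule laurent_expansionI[OF A, of "N + 1"])
    fix K
    have "(\<Sum>k\<in>{N..<K-1}. fls_nth g k * gamma_weight A k n)
          = (\<Sum>k\<in>{N+1..<K}. fls_nth (fls_X * g) k * gamma_weight A k (Suc n))" for n
      by (rule sum.reindex_bij_witness[of _ "\<lambda>k. k - 1" "\<lambda>k. k + 1"])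
         (auto simp: fls_X_times_conv_shift gamma_weight_Suc)
    with laurent_expansionD[OF f N, of N "K - 1"]
    have "(\<lambda>n. f (Suc n) - (\<Sum>k\<in>{N+1..<K}. fls_nth (fls_X * g) k * gamma_weight A k (Suc n)))
            \<in> O(\<lambda>n. gamma_weight A K (Suc n))"
      using gamma_weight_Suc[of A "K - 1"] by simp
    then show "(\<lambda>n. f n - (\<Sum>k\<in>{N+1..<K}. fls_nth (fls_X * g) k * gamma_weight A k n)) \<in> O(gamma_weight A K)"
      by (subst bigo_Suc_iff[symmetric])
  qed (use N in \<open>auto simp: fls_X_times_conv_shift\<close>)
qed

lemma laurent_expansion_fps_X_mult:
  "A > 0 \<Longrightarrow> laurent_expansion A (fps_nth f) g \<Longrightarrow> laurent_expansion A (fps_nth (fps_X * f)) (fls_X * g)"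
  by (rule laurent_expansion_shift) simp_all

lemma laurent_expansion_finite_fps_mult:
  assumes A: "A > 0" and f: "laurent_expansion A (fps_nth f) g"
    and fin: "eventually (\<lambda>n. fps_nth q n = 0) sequentially"
  shows "laurent_expansion A (fps_nth (q * f)) (fps_to_fls q * g)"
proof -
  obtain N where "\<And>n. n \<ge> N \<Longrightarrow> fps_nth q n = 0"
    using fin unfolding eventually_sequentially by blast
  then have q: "q = (\<Sum>i<N. fps_const (fps_nth q i) * fps_X ^ i)"
    by (rule finite_fps_eq_sum)
  have pow: "laurent_expansion A (fps_nth (fps_X ^ i * f)) (fls_X ^ i * g)" for i
    by (induction i) (use f laurent_expansion_fps_X_mult[OF A] in \<open>auto simp only: power_Suc mult.assoc power_0 mult_1\<close>)
  have "laurent_expansion A (\<lambda>n. \<Sum>i<N. fps_nth q i * fps_nth (fps_X ^ i * f) n)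
          (\<Sum>i<N. fls_const (fps_nth q i) * (fls_X ^ i * g))"
    by (intro laurent_expansion_sum laurent_expansion_cmult A pow)
  also have "(\<lambda>n. \<Sum>i<N. fps_nth q i * fps_nth (fps_X ^ i * f) n) = fps_nth (q * f)"
    by (subst (2) q) (simp add: fun_eq_iff sum_distrib_right fps_sum_nth mult.assoc)
  also have "(\<Sum>i<N. fls_const (fps_nth q i) * (fls_X ^ i * g)) = fps_to_fls q * g"
  proof -
    have "fps_to_fls (\<Sum>i\<in>I. p i) = (\<Sum>i\<in>I. fps_to_fls (p i))" for I :: "nat set" and p :: "nat \<Rightarrow> real fps"
      by (induction I rule: infinite_finite_induct) auto
    then show ?thesis
      by (subst (2) q) (simp add: sum_distrib_right fls_times_fps_to_fls fps_to_fls_power mult.assoc)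
  qed
  finally show ?thesis .
qed

lemma fls_theta_nth: "fls_nth (fls_X * fls_deriv g) k = of_int k * fls_nth g k"
  by (simp add: fls_X_times_conv_shift)

lemma fls_X_inv_times_nth: "fls_nth (fls_X_inv * g) k = fls_nth g (k + 1)" for g :: "real fls"
  by (subst fls_X_inv_times_conv_shift) simp

text \<open>By \<open>gamma_weight_pred\<close>, multiplying the weight of exponent \<open>k\<close>
  by \<open>n\<close> gives \<open>k\<close> times itself, hence theta, and \<open>A\<close> times
  the weight of exponent \<open>k - 1\<close>, hence the factor \<open>A / hbar\<close>.\<close>

lemma laurent_expansion_theta:
  assumes A: "A > 0" and f: "laurent_expansion A f g"
  shows "laurent_expansion A (\<lambda>n. real n * f n) (fls_X * fls_deriv g + fls_const A * fls_X_inv * g)"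
proof -
  obtain N where N: "\<And>k. k < N \<Longrightarrow> fls_nth g k = 0"
    using fls_lower_bound[of g] by metis
  let ?g = "fls_X * fls_deriv g + fls_const A * fls_X_inv * g"
  have nth: "fls_nth ?g k = of_int k * fls_nth g k + A * fls_nth g (k + 1)" for k
    by (simp add: fls_theta_nth fls_X_inv_times_nth mult.assoc)
  show ?thesis
  proof (rule laurent_expansionI[OF A, of "N - 1" _ N])
    fix K assume K: "K \<ge> N"
    \<comment> \<open>The sum runs one term further than \<open>K\<close>, since multiplication by
      \<open>n\<close> loses one order. The surplus contribution at \<open>k = K\<close> is added
      back below, being of order \<open>K\<close> itself.\<close>
    let ?S = "\<lambda>n. \<Sum>k\<in>{N..<K+1}. fls_nth g k * gamma_weight A k n"
    have "(\<lambda>n. real n * (f n - ?S n)) \<in> O(gamma_weight A (K + 1 - 1))"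
      using laurent_expansionD[OF f N] by (subst real_mult_bigo_iff[OF A]) auto
    then have big: "(\<lambda>n. real n * (f n - ?S n) + of_int K * fls_nth g K * gamma_weight A K n) \<in> O(gamma_weight A K)"
      by (intro sum_in_bigo(1)) auto
    have ev: "eventually (\<lambda>n. real n * (f n - ?S n) + of_int K * fls_nth g K * gamma_weight A K n
        = real n * f n - (\<Sum>k\<in>{N-1..<K}. fls_nth ?g k * gamma_weight A k n)) sequentially"
      using eventually_gt_int[of K]
    proof eventually_elim
      case (elim n)
      have "real n * ?S n = (\<Sum>k\<in>{N..<K+1}. fls_nth g k * (of_int k * gamma_weight A k n + A * gamma_weight A (k - 1) n))"
        unfolding sum_distrib_left
      proof (intro sum.cong refl)
        fix k assume "k \<in> {N..<K+1}"
        then have "real n * gamma_weight A k n = of_int k * gamma_weight A k n + A * gamma_weight A (k - 1) n"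
          using gamma_weight_pred[OF A, of k n] elim by (simp add: algebra_simps)
        then show "real n * (fls_nth g k * gamma_weight A k n)
              = fls_nth g k * (of_int k * gamma_weight A k n + A * gamma_weight A (k - 1) n)"
          by (metis mult.left_commute)
      qed
      also have "\<dots> = (\<Sum>k\<in>{N..<K+1}. of_int k * fls_nth g k * gamma_weight A k n)
                   + (\<Sum>k\<in>{N..<K+1}. A * fls_nth g k * gamma_weight A (k - 1) n)"
        by (simp add: algebra_simps sum.distrib)
      also have "(\<Sum>k\<in>{N..<K+1}. A * fls_nth g k * gamma_weight A (k - 1) n)
                 = (\<Sum>k\<in>{N-1..<K}. A * fls_nth g (k + 1) * gamma_weight A k n)"
        by (rule sum.reindex_bij_witness[of _ "\<lambda>k. k + 1" "\<lambda>k. k - 1"]) auto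
      also have "(\<Sum>k\<in>{N..<K+1}. of_int k * fls_nth g k * gamma_weight A k n)
                 = (\<Sum>k\<in>insert K {N..<K}. of_int k * fls_nth g k * gamma_weight A k n)"
        using K by (intro sum.cong) auto
      also have "\<dots> = of_int K * fls_nth g K * gamma_weight A K n
                     + (\<Sum>k\<in>{N..<K}. of_int k * fls_nth g k * gamma_weight A k n)"
        by simp
      also have "(\<Sum>k\<in>{N..<K}. of_int k * fls_nth g k * gamma_weight A k n)
                 = (\<Sum>k\<in>{N-1..<K}. of_int k * fls_nth g k * gamma_weight A k n)"
        using N by (intro sum.mono_neutral_left) auto
      finally show ?case
        unfolding nth by (simp add: algebra_simps sum.distrib)
    qed
    show "(\<lambda>n. real n * f n - (\<Sum>k\<in>{N-1..<K}. fls_nth ?g k * gamma_weight A k n)) \<in> O(gamma_weight A K)"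
      using big landau_o.big.in_cong[OF ev] by blast
  qed (use N in \<open>simp add: nth del: fls_plus_nth\<close>)
qed

text \<open>Otherwise the lowest term of \<open>g - g'\<close> would be of smaller order than
  itself.\<close>

lemma laurent_expansion_unique:
  assumes A: "A > 0" and "laurent_expansion A f g" "laurent_expansion A f g'"
  shows "g = g'"
proof (rule ccontr)
  assume "g \<noteq> g'"
  define d where "d = g - g'"
  define s where "s = fls_subdegree d"
  have ds: "fls_nth d s \<noteq> 0"
    using \<open>g \<noteq> g'\<close> unfolding s_def by (intro nth_fls_subdegree_nonzero) (simp add: d_def)
  have "laurent_expansion A (\<lambda>n. 0) d"
    using laurent_expansion_diff[OF assms] by (simp add: d_def)
  then have "(\<lambda>n. 0 - (\<Sum>k\<in>{s..<s+1}. fls_nth d k * gamma_weight A k n)) \<in> O(gamma_weight A (s + 1))"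
    by (rule laurent_expansionD) (simp add: s_def)
  also have "{s..<s+1} = {s}"
    by auto
  finally have "gamma_weight A s \<in> O(gamma_weight A (s + 1))"
    using ds by simp
  with gamma_weight_smallo[OF A, of s "s + 1"] have "gamma_weight A s \<in> o(gamma_weight A s)"
    using landau_o.big_small_trans by auto
  then have "eventually (\<lambda>n. gamma_weight A s n = 0) sequentially"
    by (simp add: landau_o.small_refl_iff)
  then have "eventually (\<lambda>n. False) sequentially"
    using eventually_gt_int[of s] by eventually_elim (use gamma_weight_pos[OF A] in force)
  then show False
    by simp
qed

section \<open>Comparison with factorial expansions and the asymptotic operator\<close>

lemma gamma_weight_shift_bigo_iff:
  assumes "A > 0"
  shows "f \<in> O(\<lambda>n. A powr (- real n) * Gamma (real n + of_int b - real R)) \<longleftrightarrow> f \<in> O(gamma_weight A (int R - b))"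
proof -
  have "gamma_weight A (int R - b) = (\<lambda>n. A powr of_int (int R - b) * (A powr (- real n) * Gamma (real n + of_int b - real R)))"
    using assms by (simp add: gamma_weight_def fun_eq_iff powr_add[symmetric] algebra_simps)
  then show ?thesis
    using assms by simp
qed

lemma factorial_sum_eq_laurent_sum:
  assumes "\<And>k. c k = fls_nth g (int k - b)"
  shows "(\<Sum>k<R. c k * A powr (- real n - of_int b + real k) * Gamma (real n + of_int b - real k))
         = (\<Sum>k\<in>{-b..<int R - b}. fls_nth g k * gamma_weight A k n)"
  by (rule sum.reindex_bij_witness[of _ "\<lambda>k. nat (k + b)" "\<lambda>k. int k - b"])
     (auto simp: assms gamma_weight_def algebra_simps)

lemma laurent_expansion_imp_factorial:
  assumes A: "A > 0" and f: "laurent_expansion A (\<lambda>n. fls_nth f (int n)) g"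
  obtains \<beta> c where "factorial_expansion A f \<beta> c" "fls_real_coeff g = shifted_series_coeff \<beta> c"
proof -
  obtain N where N: "\<And>k. k < N \<Longrightarrow> fls_nth g k = 0"
    using fls_lower_bound[of g] by metis
  \<comment> \<open>With \<open>\<beta> = - N\<close> the exponents \<open>k - \<beta>\<close> start
    at the lower bound \<open>N\<close>.\<close>
  define b where "b = - N"
  define c where "c k = fls_nth g (int k - b)" for k
  have "factorial_expansion A f (of_int b) c"
    unfolding factorial_expansion_def gamma_weight_shift_bigo_iff[OF A] factorial_sum_eq_laurent_sum[of c, OF c_def]
    using laurent_expansionD[OF f N] A by (simp add: b_def)
  moreover have "fls_real_coeff g = shifted_series_coeff (of_int b) c"
  proof
    fix x
    show "fls_real_coeff g x = shifted_series_coeff (of_int b) c x"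
    proof (cases "\<exists>k. real k - of_int b = x")
      case True
      then obtain k where k: "x = real k - of_int b"
        by auto
      have "{l. real l - of_int b = x} = {k}"
        by (auto simp: k)
      moreover have "x = of_int (int k - b)"
        by (simp add: k)
      ultimately show ?thesis
        by (simp add: fls_real_coeff_def shifted_series_coeff_def c_def)
    next
      case False
      have "fls_nth g i = 0" if "x = of_int i" for i
      proof (rule N, rule ccontr)
        assume "\<not> i < N"
        then have "real (nat (i + b)) - of_int b = x"
          by (simp add: that b_def)
        with False show False
          by blast
      qed
      moreover have "{l. real l - of_int b = x} = {}"
        using False by auto
      ultimately show ?thesis
        by (auto simp: fls_real_coeff_def shifted_series_coeff_def elim!: Ints_cases)
    qed
  qed
  ultimately show ?thesis
    using that by blast
qed

text \<open>For integral \<open>\<beta>\<close> this is a change of index. For other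
  \<open>\<beta>\<close> the Laurent series \<open>g\<close> has no coefficient at the exponents
  \<open>k - \<beta>\<close>, so all \<open>c k\<close> and \<open>g\<close> vanish, and
  \<open>f\<close> is smaller than every weight. This makes the description in
  \<open>asymp_op\<close> unique.\<close>

lemma factorial_imp_laurent_expansion:
  assumes f: "factorial_expansion A f \<beta> c" and g: "fls_real_coeff g = shifted_series_coeff \<beta> c"
  shows "laurent_expansion A (\<lambda>n. fls_nth f (int n)) g"
proof -
  have A: "A > 0"
    using f by (simp add: factorial_expansion_def)
  have c: "c k = fls_real_coeff g (real k - \<beta>)" for k
  proof -
    have "{l. real l - \<beta> = real k - \<beta>} = {k}"
      by auto
    then show ?thesis
      by (simp add: g shifted_series_coeff_def)
  qed
  show ?thesis
  proof (cases "\<beta> \<in> \<int>")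
    case True
    then obtain b where b: "\<beta> = of_int b"
      by (elim Ints_cases)
    have cb: "c k = fls_nth g (int k - b)" for k
    proof -
      have "real k - \<beta> = of_int (int k - b)"
        by (simp add: b)
      then show ?thesis
        unfolding c fls_real_coeff_def by (simp only: Ints_of_int floor_of_int if_True)
    qed
    have low: "fls_nth g k = 0" if "k < - b" for k
    proof -
      have "{l. real l - \<beta> = of_int k} = {}"
        using that by (auto simp: b)
      then have "fls_real_coeff g (of_int k) = 0"
        by (simp add: g shifted_series_coeff_def)
      then show ?thesis
        by (simp add: fls_real_coeff_def)
    qed
    show ?thesis
    proof (rule laurent_expansionI[OF A low, of _ "- b"])
      fix K assume "K \<ge> - b"
      then have K: "int (nat (K + b)) - b = K"
        by simp
      show "(\<lambda>n. fls_nth f (int n) - (\<Sum>k\<in>{- b..<K}. fls_nth g k * gamma_weight A k n)) \<in> O(gamma_weight A K)"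
        using f
        unfolding factorial_expansion_def b gamma_weight_shift_bigo_iff[OF A] factorial_sum_eq_laurent_sum[of c, OF cb]
        by (metis K)
    qed
  next
    case False
    have "real k - \<beta> \<notin> \<int>" for k
      using False by (metis Ints_diff Ints_of_nat diff_diff_eq2 add_diff_cancel_left')
    then have c0: "c k = 0" for k
      by (simp add: c fls_real_coeff_def)
    have "fls_nth g k = 0" for k
      using fun_cong[OF g, of "of_int k"] c0 by (simp add: fls_real_coeff_def shifted_series_coeff_def)
    then have g0: "g = 0"
      by (simp add: fls_eq_iff)
    show ?thesis
    proof (rule laurent_expansionI[OF A, of 0])
      fix K
      \<comment> \<open>Any truncation order may be used as all \<open>c k\<close> are 0; this one
        makes the argument of \<open>Gamma\<close> smaller than \<open>n - K\<close>.\<close>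
      obtain R :: nat where R: "real R > \<beta> + of_int K"
        using reals_Archimedean2 by blast
      have "(\<lambda>n. fls_nth f (int n)) \<in> O(\<lambda>n. A powr (- real n) * Gamma (real n + \<beta> - real R))"
        using f by (simp add: factorial_expansion_def c0)
      also have "(\<lambda>n. A powr (- real n) * Gamma (real n + \<beta> - real R)) \<in> O(gamma_weight A K)"
      proof (rule bigoI)
        \<comment> \<open>From \<open>n = M\<close> on the arguments are at least
          \<open>3 / 2\<close>, where \<open>Gamma\<close> is strictly increasing.\<close>
        obtain M :: nat where M: "real M \<ge> 3 / 2 - \<beta> + real R"
          using real_arch_simple by blast
        show "eventually (\<lambda>n. norm (A powr (- real n) * Gamma (real n + \<beta> - real R))
                \<le> A powr (- of_int K) * norm (gamma_weight A K n)) sequentially"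
          using eventually_ge_at_top[of M]
        proof eventually_elim
          case (elim n)
          then have n: "3 / 2 \<le> real n + \<beta> - real R"
            using M by linarith
          have "Gamma (real n + \<beta> - real R) < Gamma (real n - of_int K)"
            using R n by (intro Gamma_real_strict_mono) linarith+
          moreover have "Gamma (real n + \<beta> - real R) > 0"
            using n by (intro Gamma_real_pos) linarith
          moreover have "A powr (- of_int K) * gamma_weight A K n = A powr (- real n) * Gamma (real n - of_int K)"
            unfolding gamma_weight_def mult.assoc[symmetric] powr_add[symmetric] by simp
          moreover have "norm (gamma_weight A K n) = gamma_weight A K n"
            using calculation A by (simp add: gamma_weight_def)
          ultimately show ?case
            using A by simp
        qed
      qed
      finally show "(\<lambda>n. fls_nth f (int n) - (\<Sum>k\<in>{0..<K}. fls_nth g k * gamma_weight A k n)) \<in> O(gamma_weight A K)"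
        by (simp add: g0)
    qed (simp add: g0)
  qed
qed

lemma laurent_expansion_imp_has_factorial_expansion:
  "A > 0 \<Longrightarrow> laurent_expansion A (\<lambda>n. fls_nth f (int n)) g \<Longrightarrow> has_factorial_expansion A f"
  unfolding has_factorial_expansion_def by (metis laurent_expansion_imp_factorial)

lemma asymp_op_eqI:
  assumes A: "A > 0" and f: "laurent_expansion A (\<lambda>n. fls_nth f (int n)) g"
  shows "asymp_op A f = g"
  unfolding asymp_op_def
proof (rule the_equality)
  show "\<exists>\<beta> c. factorial_expansion A f \<beta> c \<and> fls_real_coeff g = shifted_series_coeff \<beta> c"
    using laurent_expansion_imp_factorial[OF A f] by blast
  fix g' assume "\<exists>\<beta> c. factorial_expansion A f \<beta> c \<and> fls_real_coeff g' = shifted_series_coeff \<beta> c"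
  then show "g' = g"
    using factorial_imp_laurent_expansion laurent_expansion_unique[OF A _ f] by blast
qed

section \<open>The coefficients of the partition function\<close>

lemma Z0_nth_0 [simp]: "fps_nth Z0 0 = 1"
  by (simp add: Z0_def)

text \<open>Three new factors of the double factorial stand against
  \<open>36 * (2n + 1) * (2n + 2)\<close>; the middle one, \<open>6n + 3\<close>, cancels
  \<open>2n + 1\<close>.\<close>

lemma Z0_nth_Suc:
  "real (Suc n) * fps_nth Z0 (Suc n) = 3 / 2 * (real n + 1 / 6) * (real n + 5 / 6) * fps_nth Z0 n"
proof -
  define P where "P = (\<Prod>i<3*n. real (2*i + 1))"
  define F where "F = (fact 3 ^ (2*n) * fact (2*n) :: real)"
  have F: "F \<noteq> 0"
    by (simp add: F_def)
  have "3 * Suc n = Suc (Suc (Suc (3 * n)))"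
    and "real (2 * (3 * n) + 1) = 6 * real n + 1" "real (2 * Suc (3 * n) + 1) = 6 * real n + 3"
    "real (2 * Suc (Suc (3 * n)) + 1) = 6 * real n + 5"
    by simp_all
  then have "(\<Prod>i<3*Suc n. real (2*i + 1)) = P * ((6 * real n + 1) * (6 * real n + 3) * (6 * real n + 5))"
    by (simp only: P_def prod.lessThan_Suc mult.assoc)
  moreover have "fact 3 ^ (2*Suc n) * fact (2*Suc n) = F * (36 * ((2 * real n + 1) * (2 * real n + 2)))"
    by (simp add: F_def fact_numeral algebra_simps)
  ultimately have "fps_nth Z0 (Suc n) = P * ((6 * real n + 1) * (6 * real n + 3) * (6 * real n + 5)) / (F * (36 * ((2 * real n + 1) * (2 * real n + 2))))"
    by (simp only: Z0_def fps_nth_Abs_fps)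
  moreover have "fps_nth Z0 n = P / F"
    by (simp add: Z0_def P_def F_def)
  \<comment> \<open>The factors \<open>v = 2n + 1\<close> and \<open>s = n + 1\<close> are made
    opaque so that they cancel as units.\<close>
  moreover have "s * (P * ((6 * x + 1) * (3 * v) * (6 * x + 5)) / (F * (36 * (v * (2 * s)))))
                 = 3 / 2 * (x + 1 / 6) * (x + 5 / 6) * (P / F)" if "v \<noteq> 0" "s \<noteq> 0" for s v x :: real
    using that F by (simp add: field_simps)
  from this[of "2 * real n + 1" "real n + 1" "real n"]
  have "(real n + 1) * (P * ((6 * real n + 1) * (6 * real n + 3) * (6 * real n + 5))
          / (F * (36 * ((2 * real n + 1) * (2 * real n + 2)))))
        = 3 / 2 * (real n + 1 / 6) * (real n + 5 / 6) * (P / F)"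
    by (simp add: distrib_left)
  ultimately show ?thesis
    by (simp only: of_nat_Suc add.commute[of 1])
qed

text \<open>The coefficients of the hypergeometric series 2F0 with parameters 1/6 and 5/6, up to
  powers of 2 those in the asymptotics of the Airy function. The factor \<open>(3/2)^n\<close> of
  \<open>Z0\<close> is split off, so that \<open>A\<close> becomes 1.\<close>

definition airy_coeff :: "nat \<Rightarrow> real" where
  "airy_coeff n = pochhammer (1 / 6) n * pochhammer (5 / 6) n / fact n"

lemma airy_coeff_pos: "airy_coeff n > 0"
  by (simp add: airy_coeff_def pochhammer_pos)

lemma airy_coeff_Suc:
  "(real n + 1) * airy_coeff (Suc n) = (real n + 1 / 6) * (real n + 5 / 6) * airy_coeff n"
proof -
  have "real n + 1 \<noteq> 0"
    by linarith
  then show ?thesis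
    by (simp add: airy_coeff_def pochhammer_rec' divide_simps) algebra
qed

lemma Z0_nth: "fps_nth Z0 n = (3 / 2) ^ n * airy_coeff n"
proof (induction n)
  case 0
  then show ?case
    by (simp add: airy_coeff_def)
next
  case (Suc n)
  have "real (Suc n) * fps_nth Z0 (Suc n) = (3 / 2) ^ Suc n * ((real n + 1 / 6) * (real n + 5 / 6) * airy_coeff n)"
    unfolding Z0_nth_Suc Suc by simp
  also have "\<dots> = real (Suc n) * ((3 / 2) ^ Suc n * airy_coeff (Suc n))"
    unfolding airy_coeff_Suc[symmetric] by (simp add: algebra_simps)
  finally show ?case
    by (simp only: mult_cancel_left of_nat_eq_0_iff nat.simps) simp
qed

lemma Gamma_1_6_times_Gamma_5_6: "Gamma (1 / 6) * Gamma (5 / 6) = (2 * pi :: real)"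
proof -
  have "complex_of_real (Gamma (1 / 6) * Gamma (5 / 6)) = Gamma (1 / 6) * Gamma (1 - 1 / 6)"
    by (simp flip: Gamma_complex_of_real)
  also have "\<dots> = of_real pi / sin (of_real (pi / 6))"
    by (subst Gamma_reflection_complex) simp
  also have "\<dots> = of_real pi / of_real (sin (pi / 6))"
    by (simp only: sin_of_real)
  also have "\<dots> = of_real (2 * pi)"
    by (simp add: sin_30)
  finally show ?thesis
    by (simp only: of_real_eq_iff)
qed

text \<open>Euler's limit formula turns the two Pochhammer symbols into
  \<open>1 / (Gamma (1/6) * Gamma (5/6))\<close>, which the reflection formula evaluates.\<close>

lemma airy_coeff_asymp: "(\<lambda>n. airy_coeff n / gamma_weight 1 0 n) \<longlonglongrightarrow> 1 / (2 * pi)"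
proof -
  have "(\<lambda>n. Gamma_series (1 / 6) n * Gamma_series (5 / 6) n) \<longlonglongrightarrow> Gamma (1 / 6) * Gamma (5 / 6 :: real)"
    by (intro tendsto_intros)
  \<comment> \<open>\<open>Gamma_series\<close> at \<open>n\<close> contains the Pochhammer symbol
    at \<open>Suc n\<close>, hence the index shift. The factor \<open>n / (n + 1)\<close> accounts
    for \<open>n^(1/6) * n^(5/6) = n\<close> and for \<open>fact (Suc n)\<close> in
    \<open>airy_coeff (Suc n)\<close>.\<close>
  then have "(\<lambda>n. 1 / (Gamma_series (1 / 6) n * Gamma_series (5 / 6) n) * (real n / (real n + 1))) \<longlonglongrightarrow> 1 / (2 * pi) * 1"
    unfolding Gamma_1_6_times_Gamma_5_6
    by (intro tendsto_mult[OF tendsto_divide[OF tendsto_const]]) (simp_all, real_asymp)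
  moreover have "eventually (\<lambda>n. 1 / (Gamma_series (1 / 6) n * Gamma_series (5 / 6) n) * (real n / (real n + 1))
      = airy_coeff (Suc n) / gamma_weight 1 0 (Suc n)) sequentially"
    using eventually_gt_at_top[of 0]
  proof eventually_elim
    case (elim n)
    have "exp (ln (real n) * 1 / 6) * exp (ln (real n) * 5 / 6) = real n"
      using elim by (simp flip: exp_add)
    then have "Gamma_series (1 / 6) n * Gamma_series (5 / 6) n
        = fact n * fact n * real n / (pochhammer (1 / 6) (Suc n) * pochhammer (5 / 6) (Suc n))"
      by (simp add: Gamma_series_def mult_ac)
    moreover have "gamma_weight 1 0 (Suc n) = fact n"
      using gamma_weight_of_nat[of 1 0 "Suc n"] by simp
    moreover have "1 / (f * f * m / (p * q)) * (m / (m + 1)) = p * q / ((m + 1) * f) / f"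
      if "m \<noteq> 0" for f m p q :: real
      using that by (simp add: divide_simps)
    ultimately show ?case
      using elim by (simp add: airy_coeff_def add.commute[of 1] del: pochhammer_Suc)
  qed
  ultimately have "(\<lambda>n. airy_coeff (Suc n) / gamma_weight 1 0 (Suc n)) \<longlonglongrightarrow> 1 / (2 * pi)"
    using tendsto_cong by force
  then show ?thesis
    by (rule filterlim_sequentially_Suc[THEN iffD1])
qed

text \<open>Summing the increments from \<open>n\<close> to infinity, the bounds telescope.\<close>

lemma abs_diff_limit_le_telescoping:
  fixes r t :: "nat \<Rightarrow> real"
  assumes ev: "eventually (\<lambda>n. \<bar>r (Suc n) - r n\<bar> \<le> C * (t n - t (Suc n))) sequentially"
    and r: "r \<longlonglongrightarrow> L" and t: "t \<longlonglongrightarrow> 0"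
  shows "eventually (\<lambda>n. \<bar>r n - L\<bar> \<le> C * t n) sequentially"
proof -
  obtain N where N: "\<And>n. n \<ge> N \<Longrightarrow> \<bar>r (Suc n) - r n\<bar> \<le> C * (t n - t (Suc n))"
    using ev unfolding eventually_sequentially by blast
  have "\<bar>r n - L\<bar> \<le> C * t n" if "n \<ge> N" for n
  proof -
    have step: "\<bar>r n - r (m + n)\<bar> \<le> C * (t n - t (m + n))" for m
    proof (induction m)
      case (Suc m)
      then show ?case
        using N[of "m + n"] that by (simp add: algebra_simps abs_le_iff)
    qed simp
    have "(\<lambda>m. \<bar>r n - r (m + n)\<bar>) \<longlonglongrightarrow> \<bar>r n - L\<bar>"
      by (intro tendsto_intros LIMSEQ_ignore_initial_segment r)
    moreover have "(\<lambda>m. C * (t n - t (m + n))) \<longlonglongrightarrow> C * (t n - 0)"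
      by (intro tendsto_intros LIMSEQ_ignore_initial_segment t)
    ultimately show ?thesis
      using LIMSEQ_le step by fastforce
  qed
  then show ?thesis
    unfolding eventually_sequentially by blast
qed

text \<open>
  The truncated sums satisfy the first-order recurrence of \<^const>\<open>airy_coeff\<close> up to a single
  term, because consecutive summands cancel.
\<close>

lemma airy_truncation_recurrence:
  assumes "n \<ge> K"
  defines "S \<equiv> \<lambda>K n. \<Sum>k<K. (- 1) ^ k * airy_coeff k * gamma_weight 1 (int k) n"
  shows "(real n + 1) * S K (Suc n) - (real n + 1 / 6) * (real n + 5 / 6) * S K n
         = (- 1) ^ K * real K * airy_coeff K * gamma_weight 1 (int K - 1) n"
  using assms(1)
proof (induction K)
  case 0
  then show ?case
    by (simp add: S_def)
next
  case (Suc K)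
  define w where "w = gamma_weight 1 (int K) n"
  have pred: "gamma_weight 1 (int K - 1) n = (real n - real K) * w"
    using gamma_weight_pred[of 1 "int K" n] Suc.prems by (simp add: w_def)
  have "S (Suc K) (Suc n) = S K (Suc n) + (- 1) ^ K * airy_coeff K * ((real n - real K) * w)"
    using gamma_weight_Suc[of 1 "int K - 1" n] pred by (simp add: S_def)
  moreover have "S (Suc K) n = S K n + (- 1) ^ K * airy_coeff K * w"
    by (simp add: S_def w_def)
  moreover have "(real n + 1) * S K (Suc n) - (real n + 1 / 6) * (real n + 5 / 6) * S K n
         = (- 1) ^ K * real K * airy_coeff K * ((real n - real K) * w)"
    using Suc pred by simp
  \<comment> \<open>The dependence on \<open>m\<close> cancels: \<open>(m + 1 + k) * (m - k) - (m +
    1/6) * (m + 5/6) = - (k + 1/6) * (k + 5/6)\<close>. This is the factor that leads from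
    \<open>airy_coeff k\<close> to \<open>airy_coeff (Suc k)\<close>.\<close>
  moreover have "(m + 1) * (x + c * a * ((m - k) * w)) - P * (y + c * a * w) = - c * ((k + 1 / 6) * (k + 5 / 6) * a) * w"
    if "(m + 1) * x - P * y = c * k * a * ((m - k) * w)" "P = (m + 1 / 6) * (m + 5 / 6)" for a c k m x y P :: real
  proof -
    have "(m + 1) * (x + c * a * ((m - k) * w)) - P * (y + c * a * w)
        = c * k * a * ((m - k) * w) + c * a * w * ((m + 1) * (m - k) - P)"
      unfolding that(1)[symmetric] by algebra
    then show ?thesis
      by (simp add: that(2) field_simps)
  qed
  ultimately have "(real n + 1) * S (Suc K) (Suc n) - (real n + 1 / 6) * (real n + 5 / 6) * S (Suc K) n
      = - ((- 1) ^ K) * ((real K + 1 / 6) * (real K + 5 / 6) * airy_coeff K) * w"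
    by simp
  also have "\<dots> = (- 1) ^ Suc K * real (Suc K) * airy_coeff (Suc K) * gamma_weight 1 (int (Suc K) - 1) n"
    unfolding airy_coeff_Suc[symmetric] by (simp add: w_def algebra_simps)
  finally show ?case .
qed

text \<open>The quotient \<open>r\<close> of truncated sum and coefficient tends to
  \<open>2 * pi\<close>. By \<open>airy_truncation_recurrence\<close> the numerator of its increment
  is a single small term, so telescoping bounds \<open>r n - 2 * pi\<close> by a multiple of
  \<open>t n\<close>.\<close>

lemma airy_coeff_expansion:
  assumes K: "K \<ge> 1"
  shows "(\<lambda>n. airy_coeff n - (\<Sum>k<K. 1 / (2 * pi) * (- 1) ^ k * airy_coeff k * gamma_weight 1 (int k) n))
           \<in> O(gamma_weight 1 (int K))"
proof -
  let ?w = "gamma_weight 1"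
  define S where "S n = (\<Sum>k<K. (- 1) ^ k * airy_coeff k * ?w (int k) n)" for n
  define r where "r n = S n / airy_coeff n" for n
  define t where "t n = ?w (int K) n / ?w 0 n" for n
  \<comment> \<open>The factor \<open>4 * pi\<close> comes from the lower bound
    \<open>1 / (4 * pi)\<close>, half of the limit of
    \<open>airy_coeff n / gamma_weight 1 0 n\<close>.\<close>
  define C where "C = real K * airy_coeff K * (4 * pi)"
  have wpos: "eventually (\<lambda>n. ?w k n > 0) sequentially" for k
    using eventually_gt_int[of k] by eventually_elim (simp add: gamma_weight_pos)
  have ratio: "(\<lambda>n. ?w (int k) n / ?w 0 n) \<longlonglongrightarrow> (if k = 0 then 1 else 0)" for k
  proof (cases "k = 0")
    case True
    have "eventually (\<lambda>n. ?w 0 n / ?w 0 n = 1) sequentially"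
      using wpos[of 0] by eventually_elim simp
    then show ?thesis
      using True by (simp add: tendsto_eventually)
  next
    case False
    then show ?thesis
      using smalloD_tendsto[OF gamma_weight_smallo[of 1 0 "int k"]] by simp
  qed
  have S_lim: "(\<lambda>n. S n / ?w 0 n) \<longlonglongrightarrow> 1"
  proof -
    have "(\<lambda>n. \<Sum>k<K. (- 1) ^ k * airy_coeff k * (?w (int k) n / ?w 0 n))
            \<longlonglongrightarrow> (\<Sum>k<K. (- 1) ^ k * airy_coeff k * (if k = 0 then 1 else 0))"
      by (intro tendsto_intros ratio)
    also have "(\<Sum>k<K. (- 1) ^ k * airy_coeff k * (if k = 0 then 1 else 0)) = (1 :: real)"
      using K by (simp add: if_distrib airy_coeff_def sum.delta cong: if_cong)
    finally show ?thesis
      by (simp add: S_def sum_divide_distrib)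
  qed
  have r_lim: "r \<longlonglongrightarrow> 2 * pi"
  proof -
    have "(\<lambda>n. (S n / ?w 0 n) / (airy_coeff n / ?w 0 n)) \<longlonglongrightarrow> 1 / (1 / (2 * pi))"
      by (intro tendsto_divide S_lim airy_coeff_asymp) simp
    moreover have "eventually (\<lambda>n. (S n / ?w 0 n) / (airy_coeff n / ?w 0 n) = r n) sequentially"
      using wpos[of 0] by eventually_elim (simp add: r_def)
    ultimately show ?thesis
      using tendsto_cong by force
  qed
  have t_lim: "t \<longlonglongrightarrow> 0"
    using ratio[of K] K unfolding t_def by simp
  have low: "eventually (\<lambda>n. airy_coeff n / ?w 0 n > 1 / (4 * pi)) sequentially"
    by (rule order_tendstoD(1)[OF airy_coeff_asymp]) (simp add: field_simps)
  have "eventually (\<lambda>n. airy_coeff (Suc n) / ?w 0 (Suc n) > 1 / (4 * pi)) sequentially"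
    by (rule eventually_sequentially_Suc[THEN iffD2, OF low])
  then have "eventually (\<lambda>n. \<bar>r (Suc n) - r n\<bar> \<le> C * (t n - t (Suc n))) sequentially"
    using eventually_gt_at_top[of K]
  proof eventually_elim
    case (elim n)
    have n: "real n > real K" "real n > 0"
      using elim K by auto
    define u where "u = ?w 0 n"
    define v where "v = ?w (int K) n"
    have u: "u > 0" and v: "v > 0"
      using gamma_weight_pos[of 1 0 n] gamma_weight_pos[of 1 "int K" n] elim by (auto simp: u_def v_def)
    have uS: "?w 0 (Suc n) = real n * u"
      using gamma_weight_Suc[of 1 "- 1" n] gamma_weight_pred[of 1 0 n] elim by (simp add: u_def)
    have vp: "?w (int K - 1) n = (real n - real K) * v"
      using gamma_weight_pred[of 1 "int K" n] elim by (simp add: v_def)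
    have vS: "?w (int K) (Suc n) = (real n - real K) * v"
      using gamma_weight_Suc[of 1 "int K - 1" n] vp by simp
    have a: "airy_coeff (Suc n) \<ge> real n * u / (4 * pi)"
      using elim(1) u n unfolding uS by (simp add: field_simps)
    \<comment> \<open>That is, \<open>t n - t (Suc n) = (K / n) * t n\<close>, the same size as the
      increments of \<open>r\<close>.\<close>
    have tdiff: "t n - t (Suc n) = real K * v / (real n * u)"
      unfolding t_def uS vS using u n by (simp add: u_def[symmetric] v_def[symmetric] field_simps)
    have "r (Suc n) - r n = ((real n + 1) * S (Suc n) - (real n + 1 / 6) * (real n + 5 / 6) * S n)
                              / ((real n + 1) * airy_coeff (Suc n))"
    proof -
      have "r n = (real n + 1 / 6) * (real n + 5 / 6) * S n / ((real n + 1 / 6) * (real n + 5 / 6) * airy_coeff n)"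
        using n by (simp add: r_def)
      also have "\<dots> = (real n + 1 / 6) * (real n + 5 / 6) * S n / ((real n + 1) * airy_coeff (Suc n))"
        by (simp only: airy_coeff_Suc)
      moreover have "r (Suc n) = (real n + 1) * S (Suc n) / ((real n + 1) * airy_coeff (Suc n))"
        using n by (simp add: r_def)
      ultimately show ?thesis
        by (simp add: diff_divide_distrib)
    qed
    also have "\<dots> = (- 1) ^ K * (real K * airy_coeff K * ((real n - real K) * v)) / ((real n + 1) * airy_coeff (Suc n))"
      using airy_truncation_recurrence[of K n] elim by (simp add: S_def vp)
    finally have "\<bar>r (Suc n) - r n\<bar> = real K * airy_coeff K * ((real n - real K) * v) / ((real n + 1) * airy_coeff (Suc n))"
      using n v airy_coeff_pos[of K] airy_coeff_pos[of "Suc n"] by (simp add: abs_mult)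
    \<comment> \<open>Enlarging \<open>n - K\<close> to \<open>n + 1\<close> cancels this factor of
      the denominator.\<close>
    also have "\<dots> \<le> real K * airy_coeff K * ((real n + 1) * v) / ((real n + 1) * (real n * u / (4 * pi)))"
      using n u v a airy_coeff_pos[of K]
      by (intro frac_le mult_left_mono mult_right_mono) auto
    also have "\<dots> = C * (v / (real n * u))"
      using n u by (simp add: C_def)
    also have "\<dots> \<le> C * (t n - t (Suc n))"
      unfolding tdiff using K u v n airy_coeff_pos[of K]
      by (intro mult_left_mono divide_right_mono) (auto simp: C_def)
    finally show ?case .
  qed
  then have bound: "eventually (\<lambda>n. \<bar>r n - 2 * pi\<bar> \<le> C * t n) sequentially"
    by (rule abs_diff_limit_le_telescoping[OF _ r_lim t_lim])
  have up: "eventually (\<lambda>n. airy_coeff n / ?w 0 n < 1) sequentially"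
    by (rule order_tendstoD(2)[OF airy_coeff_asymp]) (use pi_gt3 in \<open>simp add: field_simps\<close>)
  show ?thesis
  proof (rule bigoI)
    show "eventually (\<lambda>n. norm (airy_coeff n - (\<Sum>k<K. 1 / (2 * pi) * (- 1) ^ k * airy_coeff k * ?w (int k) n))
            \<le> C / (2 * pi) * norm (?w (int K) n)) sequentially"
      using bound up wpos[of 0] wpos[of "int K"]
    proof eventually_elim
      case (elim n)
      have C: "C \<ge> 0"
        using airy_coeff_pos[of K] by (simp add: C_def)
      have "(\<Sum>k<K. 1 / (2 * pi) * (- 1) ^ k * airy_coeff k * ?w (int k) n) = 1 / (2 * pi) * S n"
        unfolding S_def sum_distrib_left by (simp add: mult.assoc)
      also have "airy_coeff n - \<dots> = - (airy_coeff n / (2 * pi)) * (r n - 2 * pi)"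
        using airy_coeff_pos[of n] by (simp add: r_def field_simps)
      finally have "norm (airy_coeff n - (\<Sum>k<K. 1 / (2 * pi) * (- 1) ^ k * airy_coeff k * ?w (int k) n))
           = airy_coeff n / (2 * pi) * \<bar>r n - 2 * pi\<bar>"
        using airy_coeff_pos[of n] by (simp add: abs_mult)
      also have "\<dots> \<le> airy_coeff n / (2 * pi) * (C * t n)"
        using elim(1) airy_coeff_pos[of n] by (intro mult_left_mono) auto
      also have "\<dots> = C / (2 * pi) * ?w (int K) n * (airy_coeff n / ?w 0 n)"
        by (simp add: t_def)
      also have "\<dots> \<le> C / (2 * pi) * ?w (int K) n * 1"
        using elim C by (intro mult_left_mono) auto
      finally show ?case
        using elim by simp
    qed
  qed
qed

text \<open>Rescaling from \<open>A = 1\<close>: the factor \<open>(3/2)^k\<close> in the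
  coefficient of \<open>Z0\<close> cancels \<open>(2/3)^k\<close> in the weight, and the signs
  \<open>(- 1) ^ k\<close> become the argument \<open>- fps_X\<close>.\<close>

lemma laurent_expansion_Z0:
  "laurent_expansion (2/3) (fps_nth Z0) (fps_to_fls (fps_const (1 / (2 * pi)) * fps_compose Z0 (- fps_X)))"
proof (rule laurent_expansionI[where N = 0 and ?K0.0 = 1])
  let ?g = "fps_to_fls (fps_const (1 / (2 * pi)) * fps_compose Z0 (- fps_X))"
  fix K :: int assume "K \<ge> 1"
  then obtain K' where K': "K = int K'" "K' \<ge> 1"
    by (metis nat_int_comparison(3) of_nat_1 zero_le_imp_eq_int order.trans zero_le_one)
  have weight: "gamma_weight (2/3) k n = (3/2) ^ n * (2/3) powr of_int k * gamma_weight 1 k n" for k n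
    by (simp add: gamma_weight_def powr_diff powr_realpow power_divide field_simps)
  have sum_eq: "(\<Sum>k\<in>{0..<K}. fls_nth ?g k * gamma_weight (2/3) k n)
     = (3/2) ^ n * (\<Sum>k<K'. 1 / (2 * pi) * (- 1) ^ k * airy_coeff k * gamma_weight 1 (int k) n)" for n
  proof -
    have "fls_nth ?g (int k) * gamma_weight (2/3) (int k) n
          = (3/2) ^ n * (1 / (2 * pi) * (- 1) ^ k * airy_coeff k * gamma_weight 1 (int k) n)" for k
    proof -
      have "(3/2) ^ k * (2/3) powr real k = (1 :: real)"
        by (simp add: powr_realpow flip: power_mult_distrib)
      then have "(c * ((-1) ^ k * ((3/2) ^ k * a))) * ((3/2) ^ n * (2/3) powr real k * w)
            = (3/2) ^ n * (c * (-1) ^ k * a * w)" for a c w :: real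
        by (simp add: mult_ac)
      from this[of "1 / (2 * pi)" "airy_coeff k" "gamma_weight 1 (int k) n"] show ?thesis
        by (simp only: weight fps_to_fls_nth fps_compose_uminus' fps_nth_Abs_fps fps_mult_left_const_nth
              Z0_nth of_int_of_nat_eq nat_int of_nat_less_0_iff if_False)
    qed
    moreover have "(\<Sum>k\<in>{0..<K}. fls_nth ?g k * gamma_weight (2/3) k n)
        = (\<Sum>k<K'. fls_nth ?g (int k) * gamma_weight (2/3) (int k) n)"
      by (rule sum.reindex_bij_witness[of _ int nat]) (auto simp: K')
    ultimately show ?thesis
      by (simp only: sum_distrib_left)
  qed
  have "(\<lambda>n. (3/2) ^ n * (airy_coeff n - (\<Sum>k<K'. 1 / (2 * pi) * (- 1) ^ k * airy_coeff k * gamma_weight 1 (int k) n)))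
          \<in> O(\<lambda>n. (3/2) ^ n * gamma_weight 1 (int K') n)"
    by (intro landau_o.big.mult airy_coeff_expansion K') auto
  also have "(\<lambda>n. (3/2) ^ n * gamma_weight 1 (int K') n) \<in> O(gamma_weight (2/3) K)"
    unfolding weight[abs_def] K'
    by (intro bigoI[of _ "1 / (2/3) powr real K'"] always_eventually) (simp add: powr_realpow abs_mult)
  finally show "(\<lambda>n. fps_nth Z0 n - (\<Sum>k\<in>{0..<K}. fls_nth ?g k * gamma_weight (2/3) k n)) \<in> O(gamma_weight (2/3) K)"
    unfolding sum_eq by (simp add: Z0_nth right_diff_distrib)
qed auto

section \<open>Logarithms of factorially divergent series\<close>

lemma fps_log_deriv:
  assumes "fps_nth f 0 = 1"
  shows "fps_deriv (fps_log f) = inverse f * fps_deriv f"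
proof -
  have f0: "fps_nth (f - 1) 0 = 0"
    using assms by simp
  have "fps_deriv (fps_ln 1) oo (f - 1) = inverse ((1 + fps_X) oo (f - 1))"
    unfolding fps_ln_deriv by (simp add: fps_inverse_compose[OF f0])
  also have "(1 + fps_X) oo (f - 1) = f"
    using f0 by (simp add: fps_compose_add_distrib)
  finally show ?thesis
    unfolding fps_log_def fps_compose_deriv[OF f0] by simp
qed

text \<open>To first order the inverse changes by \<open>- h^2\<close> times the change of
  \<open>f\<close>. As \<open>f * h = 1\<close> has no asymptotics, \<open>hc * f + fc * h\<close>
  is negligible for the cutoffs \<open>hc\<close>, \<open>fc\<close>; multiply by \<open>hc\<close>
  and use that \<open>hc * fc\<close> agrees with 1 below order \<open>K\<close>.\<close>

lemma fps_inverse_bigo_cutoff: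
  fixes f h :: "real fps"
  assumes A: "A > 0" and f: "fps_nth f \<in> O(gamma_weight A 0)" and fh: "f * h = 1" and K: "K \<ge> 1"
  shows "fps_nth (h + fps_cutoff K h ^ 2 * f) \<in> O(gamma_weight A (int K))"
proof -
  let ?fc = "fps_cutoff K f" and ?hc = "fps_cutoff K h"
  note h = fps_inverse_bigo[OF A f fh]
  have "fps_nth (1 :: real fps) \<in> O(gamma_weight A (int K))"
    by (rule eventually_zero_bigo) (use eventually_gt_at_top[of 0] in \<open>eventually_elim, simp\<close>)
  from sum_in_bigo(2)[OF this fps_mult_bigo_cutoff[OF A K f h]]
  have "fps_nth (?hc * f + ?fc * h) \<in> O(gamma_weight A (int K))"
    by (simp add: fh fps_nth_add_eq)
  from finite_fps_mult_bigo[OF A finite_fps_cutoff, of 0 K h, OF _ this]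
  have 1: "fps_nth (?hc * (?hc * f + ?fc * h)) \<in> O(gamma_weight A (int K))"
    by simp
  have fin: "eventually (\<lambda>n. fps_nth (?hc * ?fc - 1) n = 0) sequentially"
    using finite_fps_mult[OF finite_fps_cutoff finite_fps_cutoff, of K h K f] eventually_gt_at_top[of 0]
    by eventually_elim simp
  have low: "fps_nth (?hc * ?fc - 1) i = 0" if "i < K" for i
    using that fh by (simp add: fps_cutoff_left_mult_nth fps_cutoff_right_mult_nth mult.commute[of h])
  have 2: "fps_nth ((?hc * ?fc - 1) * h) \<in> O(gamma_weight A (int K))"
    using finite_fps_mult_bigo[OF A fin low h] by simp
  have "h + ?hc ^ 2 * f = ?hc * (?hc * f + ?fc * h) - (?hc * ?fc - 1) * h"
    by algebra
  then show ?thesis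
    using sum_in_bigo(2)[OF 1 2] by (simp only: fps_nth_diff_eq)
qed

text \<open>
  Modulo faster decaying coefficients the logarithm depends linearly on \<open>f\<close>, with factor
  \<open>1 / f = log'(f)\<close>. Both sides are compared after applying \<open>hbar * d/dhbar\<close>.
\<close>

lemma fps_log_bigo_cutoff:
  assumes A: "A > 0" and f0: "fps_nth f 0 = 1" and f: "fps_nth f \<in> O(gamma_weight A 0)" and K: "K \<ge> 1"
  shows "fps_nth (fps_log f - fps_cutoff K (inverse f) * f) \<in> O(gamma_weight A (int K))"
proof -
  define h where "h = inverse f"
  define \<theta> where "\<theta> p = fps_X * fps_deriv p" for p :: "real fps"
  define p where "p = fps_cutoff (K - 1) (\<theta> f)"
  let ?hc = "fps_cutoff K h"
  have fh: "f * h = 1"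
    using f0 by (simp add: h_def inverse_mult_eq_1')
  note h = fps_inverse_bigo[OF A f fh]
  have "fps_nth (\<theta> f) \<in> O(gamma_weight A (0 - 1))"
    unfolding \<theta>_def by (rule fps_theta_bigo_iff[OF A, THEN iffD2]) (rule f)
  \<comment> \<open>The extra \<open>fps_X\<close> makes up for the order lost by theta, as the
    product estimate needs factors of order 0. It also explains the cutoff at \<open>K - 1\<close>
    in \<open>p\<close>.\<close>
  then have "fps_nth (fps_X * \<theta> f) \<in> O(gamma_weight A 0)"
    by (rule fps_X_mult_bigo_iff[THEN iffD2])
  from fps_mult_bigo_cutoff[OF A K this h]
  have "fps_nth (fps_X * \<theta> f * h - (?hc * (fps_X * \<theta> f) + fps_cutoff K (fps_X * \<theta> f) * h)) \<in> O(gamma_weight A (int K))" .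
  also have "fps_cutoff K (fps_X * \<theta> f) = fps_X * p"
    using K by (intro fps_ext) (auto simp: p_def)
  also have "fps_X * \<theta> f * h - (?hc * (fps_X * \<theta> f) + fps_X * p * h) = fps_X * (\<theta> f * h - ?hc * \<theta> f - p * h)"
    by (simp add: algebra_simps)
  finally have 1: "fps_nth (\<theta> f * h - ?hc * \<theta> f - p * h) \<in> O(gamma_weight A (int K - 1))"
    unfolding fps_X_mult_bigo_iff .
  have "fps_nth (p * (h + ?hc ^ 2 * f)) \<in> O(gamma_weight A (int K + int 0))"
    unfolding p_def by (rule finite_fps_mult_bigo[OF A finite_fps_cutoff _ fps_inverse_bigo_cutoff[OF A f fh K]]) simp
  then have 2: "fps_nth (p * (h + ?hc ^ 2 * f)) \<in> O(gamma_weight A (int K - 1))"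
    by (rule bigo_gamma_weight_mono[OF A, rotated]) simp
  have "eventually (\<lambda>n. fps_nth (p * ?hc ^ 2) n = 0) sequentially"
    unfolding p_def power2_eq_square by (intro finite_fps_mult finite_fps_cutoff)
  then have fin: "eventually (\<lambda>n. fps_nth (p * ?hc ^ 2 + \<theta> ?hc) n = 0) sequentially"
    using eventually_ge_at_top[of K] by eventually_elim (simp add: \<theta>_def fps_theta_nth del: fps_X_mult_nth)
  \<comment> \<open>Below order \<open>K - 1\<close> the cutoffs may be undone:
    \<open>p * hc^2\<close> agrees with \<open>h^2 * \<theta> f\<close>, which is
    \<open>- \<theta> h\<close>.\<close>
  have low: "fps_nth (p * ?hc ^ 2 + \<theta> ?hc) i = 0" if "i < K - 1" for i
  proof -
    have "fps_nth (p * ?hc ^ 2) i = fps_nth (\<theta> f * ?hc ^ 2) i"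
      using that unfolding p_def by (simp add: fps_cutoff_left_mult_nth)
    also have "\<dots> = fps_nth (?hc * (?hc * \<theta> f)) i"
      by (simp add: power2_eq_square mult_ac)
    also have "\<dots> = fps_nth (h * (?hc * \<theta> f)) i"
      using that by (simp add: fps_cutoff_left_mult_nth)
    also have "\<dots> = fps_nth (?hc * (h * \<theta> f)) i"
      by (simp add: mult_ac)
    also have "\<dots> = fps_nth (h * (h * \<theta> f)) i"
      using that by (simp add: fps_cutoff_left_mult_nth)
    also have "h * (h * \<theta> f) = - \<theta> h"
      unfolding \<theta>_def h_def using f0 by (simp add: fps_inverse_deriv power2_eq_square mult_ac)
    finally show ?thesis
      using that by (simp add: \<theta>_def fps_theta_nth del: fps_X_mult_nth)
  qed
  have 3: "fps_nth ((p * ?hc ^ 2 + \<theta> ?hc) * f) \<in> O(gamma_weight A (int K - 1))"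
    using finite_fps_mult_bigo[OF A fin low f, where M = "K - 1"] K by (simp add: of_nat_diff)
  have "\<theta> (fps_log f - ?hc * f) = h * \<theta> f - ?hc * \<theta> f - \<theta> ?hc * f"
    unfolding \<theta>_def by (simp add: fps_log_deriv[OF f0] h_def algebra_simps)
  \<comment> \<open>Three errors: that of the product \<open>\<theta> f * h\<close>, that of
    replacing \<open>h\<close> by \<open>- hc^2 * f\<close>, and a polynomial multiple of
    \<open>f\<close> which starts at order \<open>K - 1\<close>.\<close>
  also have "\<dots> = (\<theta> f * h - ?hc * \<theta> f - p * h) + p * (h + ?hc ^ 2 * f) - (p * ?hc ^ 2 + \<theta> ?hc) * f"
    by algebra
  finally have "fps_nth (\<theta> (fps_log f - ?hc * f)) \<in> O(gamma_weight A (int K - 1))"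
    using sum_in_bigo(2)[OF sum_in_bigo(1)[OF 1 2] 3] by (simp only: fps_nth_add_eq fps_nth_diff_eq)
  then show ?thesis
    unfolding \<theta>_def fps_theta_bigo_iff[OF A] h_def .
qed

text \<open>At each order \<open>K\<close> the logarithm may be replaced by a polynomial multiple of
  \<open>f\<close>, whose expansion is known; cutting off \<open>inverse f\<close> at
  \<open>K\<close> changes the product with the power series \<open>G\<close> only from exponent
  \<open>K\<close> on.\<close>

lemma laurent_expansion_fps_log:
  assumes A: "A > 0" and f0: "fps_nth f 0 = 1" and f: "laurent_expansion A (fps_nth f) (fps_to_fls G)"
  shows "laurent_expansion A (fps_nth (fps_log f)) (fps_to_fls (inverse f * G))"
proof (rule laurent_expansion_approx[OF A, of 1])
  fix K :: int assume "K \<ge> 1"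
  then obtain K' where K': "K = int K'" "K' \<ge> 1"
    by (metis nat_int_comparison(3) of_nat_1 zero_le_imp_eq_int order.trans zero_le_one)
  let ?hc = "fps_cutoff K' (inverse f)"
  have "fps_nth f \<in> O(gamma_weight A 0)"
    using laurent_expansionD[OF f, of 0 0] by simp
  from fps_log_bigo_cutoff[OF A f0 this K'(2)]
  have "(\<lambda>n. fps_nth (fps_log f) n - fps_nth (?hc * f) n) \<in> O(gamma_weight A K)"
    by (simp add: K' fps_nth_diff_eq)
  moreover have "laurent_expansion A (fps_nth (?hc * f)) (fps_to_fls (?hc * G))"
    unfolding fls_times_fps_to_fls by (rule laurent_expansion_finite_fps_mult[OF A f finite_fps_cutoff])
  moreover have "\<forall>k<K. fls_nth (fps_to_fls (inverse f * G)) k = fls_nth (fps_to_fls (?hc * G)) k"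
    by (auto simp: K' fps_cutoff_left_mult_nth)
  ultimately show "\<exists>f' g'. (\<lambda>n. fps_nth (fps_log f) n - f' n) \<in> O(gamma_weight A K) \<and>
      laurent_expansion A f' g' \<and> (\<forall>k<K. fls_nth (fps_to_fls (inverse f * G)) k = fls_nth g' k)"
    by blast
qed

section \<open>The source dependence\<close>

text \<open>The derivation \<open>hbar * d/dhbar\<close>; \<open>fps_deriv\<close> on the same ring
  is \<open>d/dj\<close>, and the two commute.\<close>

definition theta_coeffs :: "real fls fps \<Rightarrow> real fls fps" where
  "theta_coeffs F = Abs_fps (\<lambda>m. fls_X * fls_deriv (fps_nth F m))"

lemma theta_coeffs_nth [simp]: "fps_nth (theta_coeffs F) m = fls_X * fls_deriv (fps_nth F m)"
  by (simp add: theta_coeffs_def)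

lemma theta_coeffs_const [simp]: "theta_coeffs (fps_const c) = fps_const (fls_X * fls_deriv c)"
  by (intro fps_ext) simp

lemma theta_coeffs_diff [simp]: "theta_coeffs (F - G) = theta_coeffs F - theta_coeffs G"
  by (intro fps_ext) (simp add: algebra_simps)

lemma theta_coeffs_mult [simp]: "theta_coeffs (F * G) = theta_coeffs F * G + F * theta_coeffs G"
proof (rule fps_ext)
  fix n
  have "fps_nth (theta_coeffs (F * G)) n = (\<Sum>i=0..n. fls_X * fls_deriv (fps_nth F i) * fps_nth G (n - i)
          + fps_nth F i * (fls_X * fls_deriv (fps_nth G (n - i))))"
    by (simp add: fps_mult_nth fls_deriv_sum sum_distrib_left algebra_simps)
  then show "fps_nth (theta_coeffs (F * G)) n = fps_nth (theta_coeffs F * G + F * theta_coeffs G) n"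
    by (simp only: fps_add_nth fps_mult_nth theta_coeffs_nth sum.distrib)
qed

lemma theta_coeffs_deriv: "theta_coeffs (fps_deriv F) = fps_deriv (theta_coeffs F)"
  by (intro fps_ext) (simp add: algebra_simps del: of_nat_Suc of_nat_add)

text \<open>The equation determines each coefficient from the lower ones.\<close>

lemma fps_linear_ode_zero:
  fixes H P :: "'a :: field_char_0 fps"
  assumes "fps_deriv H = P * H" "fps_nth H 0 = 0"
  shows "H = 0"
proof (rule fps_ext)
  fix n
  show "fps_nth H n = fps_nth 0 n"
  proof (induction n rule: less_induct)
    case (less n)
    show ?case
    proof (cases n)
      case (Suc k)
      have "of_nat (Suc k) * fps_nth H (Suc k) = fps_nth (P * H) k"
        by (simp flip: assms(1))
      also have "\<dots> = 0"
        using less by (simp add: fps_mult_nth Suc)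
      finally show ?thesis
        by (simp only: Suc mult_eq_0_iff of_nat_eq_0_iff) simp
    qed (use assms in simp)
  qed
qed

lemma fps_exp_compose_deriv:
  fixes E :: "'a :: field_char_0 fps"
  assumes "fps_nth E 0 = 0"
  shows "fps_deriv (fps_exp 1 oo E) = fps_deriv E * (fps_exp 1 oo E)"
  using fps_compose_deriv[OF assms, of "fps_exp 1"] by (simp add: mult.commute)

text \<open>
  The two derivations commute, so the defect \<open>theta (exp E) - theta E * exp E\<close> solves a
  homogeneous linear equation in \<open>j\<close>.
\<close>

lemma theta_coeffs_exp:
  assumes "fps_nth E 0 = 0"
  shows "theta_coeffs (fps_exp 1 oo E) = theta_coeffs E * (fps_exp 1 oo E)"
proof -
  define G where "G = fps_exp 1 oo E"
  have G: "fps_deriv G = fps_deriv E * G"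
    unfolding G_def by (rule fps_exp_compose_deriv[OF assms])
  have "theta_coeffs G - theta_coeffs E * G = 0"
  proof (rule fps_linear_ode_zero)
    have "fps_deriv (theta_coeffs G) = theta_coeffs (fps_deriv E) * G + fps_deriv E * theta_coeffs G"
      unfolding theta_coeffs_deriv[symmetric] G by simp
    then show "fps_deriv (theta_coeffs G - theta_coeffs E * G) = fps_deriv E * (theta_coeffs G - theta_coeffs E * G)"
      by (simp add: G theta_coeffs_deriv algebra_simps)
    show "fps_nth (theta_coeffs G - theta_coeffs E * G) 0 = 0"
      using assms by (simp add: G_def)
  qed
  then show ?thesis
    by (simp add: G_def)
qed

text \<open>The differential equation \<open>(1 - 2j) * y' = - 2 * a * y\<close>, read off
  coefficientwise.\<close>

lemma one_minus_2j_powr_nth_Suc: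
  "real (Suc m) * fps_nth (one_minus_2j_powr a) (Suc m) = (2 * real m - 2 * a) * fps_nth (one_minus_2j_powr a) m"
proof -
  have nth: "fps_nth (one_minus_2j_powr a) m = (- 2) ^ m * (a gchoose m)" for m
  proof -
    have "- fps_const (2 :: real) = fps_const (- 2)"
      by simp
    then show ?thesis
      unfolding one_minus_2j_powr_def by (simp only: fps_compose_linear fps_nth_Abs_fps fps_binomial_nth)
  qed
  have "real (Suc m) * (a gchoose Suc m) = (a - real m) * (a gchoose m)"
    using gbinomial_mult_1[of a m] by (simp add: algebra_simps)
  then have "real (Suc m) * ((- 2) ^ Suc m * (a gchoose Suc m)) = (- 2) ^ Suc m * ((a - real m) * (a gchoose m))"
    by (subst mult.left_commute) (simp only:)
  then show ?thesis
    unfolding nth by (simp add: algebra_simps)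
qed

lemma subst_hbar_nth_0 [simp]: "fps_nth (subst_hbar f) 0 = f"
  by (intro fls_eqI) (simp add: subst_hbar_nth one_minus_2j_powr_def)

lemma subst_hbar_nth_Suc:
  "real (Suc m) * fls_nth (fps_nth (subst_hbar f) (Suc m)) n
     = (2 * real m + 3 * of_int n) * fls_nth (fps_nth (subst_hbar f) m) n"
proof -
  have "real (Suc m) * fls_nth (fps_nth (subst_hbar f) (Suc m)) n
      = fls_nth f n * (real (Suc m) * fps_nth (one_minus_2j_powr (- (3 / 2) * of_int n)) (Suc m))"
    by (simp add: subst_hbar_nth)
  also have "\<dots> = (2 * real m + 3 * of_int n) * fls_nth (fps_nth (subst_hbar f) m) n"
    unfolding one_minus_2j_powr_nth_Suc by (simp add: subst_hbar_nth algebra_simps)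
  finally show ?thesis .
qed

lemma fps_numeral_mult_nth: "fps_nth (numeral k * F) m = numeral k * fps_nth F m"
  for F :: "'a :: comm_ring_1 fps"
  by (simp add: numeral_fps_const)

lemma fps_one_minus_2X_deriv_nth:
  "fps_nth (fps_deriv F - 2 * (fps_X * fps_deriv F)) m
     = of_nat (Suc m) * fps_nth F (Suc m) - 2 * (of_nat m * fps_nth F m)"
  for F :: "'a :: comm_ring_1 fps"
  by (simp only: fps_sub_nth fps_numeral_mult_nth fps_theta_nth fps_deriv_nth Suc_eq_plus1)

text \<open>Transport equation \<open>(1 - 2j) * d/dj = 3 * theta\<close>: the series depends on
  \<open>j\<close> only through \<open>hbar * (1 - 2j)^(-3/2)\<close>, for which it holds by
  inspection.\<close>

lemma subst_hbar_deriv: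
  "fps_deriv (subst_hbar f) - 2 * (fps_X * fps_deriv (subst_hbar f)) = 3 * theta_coeffs (subst_hbar f)"
proof (rule fps_ext)
  fix m
  let ?S = "subst_hbar f"
  have "of_nat (Suc m) * fps_nth ?S (Suc m)
      = 2 * (of_nat m * fps_nth ?S m) + 3 * (fls_X * fls_deriv (fps_nth ?S m))"
  proof (intro fls_eqI)
    fix n
    show "fls_nth (of_nat (Suc m) * fps_nth ?S (Suc m)) n
        = fls_nth (2 * (of_nat m * fps_nth ?S m) + 3 * (fls_X * fls_deriv (fps_nth ?S m))) n"
      using subst_hbar_nth_Suc[of m f n]
      by (simp add: fls_of_nat fls_theta_nth distrib_right mult.assoc flip: fls_const_numeral)
  qed
  then show "fps_nth (fps_deriv ?S - 2 * (fps_X * fps_deriv ?S)) m = fps_nth (3 * theta_coeffs ?S) m"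
    unfolding fps_one_minus_2X_deriv_nth fps_numeral_mult_nth theta_coeffs_nth by simp
qed

text \<open>In the exponent \<open>E\<close>, the substituted \<open>1 / hbar\<close> obeys the
  transport equation, but the plain \<open>1 / hbar\<close> is constant in \<open>j\<close> while
  theta maps it to its negative. The exponential therefore adds \<open>3 * A / hbar\<close> to the
  equation, the term produced by \<open>laurent_expansion_theta\<close>.\<close>

lemma exp_subst_hbar_deriv:
  fixes A :: real and g :: "real fls"
  defines "E \<equiv> fps_const (fls_const A) * (fps_const fls_X_inv - subst_hbar fls_X_inv)"
  defines "F \<equiv> (fps_exp 1 oo E) * subst_hbar g"
  shows "fps_deriv F - 2 * (fps_X * fps_deriv F) = 3 * (theta_coeffs F + fps_const (fls_const A * fls_X_inv) * F)"
proof -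
  let ?Y = "subst_hbar fls_X_inv" and ?S = "subst_hbar g"
  define B where "B = fps_const (fls_const A)"
  define G where "G = fps_exp 1 oo E"
  have E0: "fps_nth E 0 = 0"
    by (simp add: E_def)
  have G: "fps_deriv G = fps_deriv E * G" "theta_coeffs G = theta_coeffs E * G"
    unfolding G_def by (rule fps_exp_compose_deriv[OF E0], rule theta_coeffs_exp[OF E0])
  have X_inv: "fls_X * fls_deriv fls_X_inv = - (fls_X_inv :: real fls)"
    by (intro fls_eqI) (simp add: fls_theta_nth del: fls_deriv_X_inv)
  have "theta_coeffs ?Y = - ?Y"
    by (intro fps_ext fls_eqI) (auto simp: fls_theta_nth subst_hbar_nth)
  then have thE: "theta_coeffs E = B * (?Y - fps_const fls_X_inv)"
    unfolding E_def B_def theta_coeffs_mult theta_coeffs_diff theta_coeffs_const X_inv \<open>theta_coeffs ?Y = - ?Y\<close>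
    by (simp add: algebra_simps)
  have dY: "fps_deriv ?Y - 2 * (fps_X * fps_deriv ?Y) = - 3 * ?Y"
    using subst_hbar_deriv[of fls_X_inv] \<open>theta_coeffs ?Y = - ?Y\<close> by simp
  have "fps_deriv E = - (B * fps_deriv ?Y)"
    unfolding E_def B_def by simp
  then have dE: "fps_deriv E - 2 * (fps_X * fps_deriv E) = 3 * (B * ?Y)"
    using dY by algebra
  have F: "F = G * ?S"
    by (simp add: F_def G_def)
  have "fps_deriv F - 2 * (fps_X * fps_deriv F)
      = (fps_deriv E - 2 * (fps_X * fps_deriv E)) * F + G * (fps_deriv ?S - 2 * (fps_X * fps_deriv ?S))"
    unfolding F fps_deriv_mult G by algebra
  also have "\<dots> = 3 * (B * ?Y) * F + G * (3 * theta_coeffs ?S)"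
    unfolding dE subst_hbar_deriv ..
  also have "\<dots> = 3 * (theta_coeffs F + B * fps_const fls_X_inv * F)"
    unfolding F theta_coeffs_mult G thE by algebra
  also have "B * fps_const fls_X_inv = fps_const (fls_const A * fls_X_inv)"
    by (simp add: B_def)
  finally show ?thesis .
qed

text \<open>Induction on \<open>m\<close>. The next coefficient of \<open>subst_hbar f\<close>
  arises by the factor \<open>(2 * m + 3 * n) / (m + 1)\<close>. On the side of expansions
  \<open>n\<close> becomes theta plus \<open>A / hbar\<close>, which is the recurrence of
  \<open>exp_subst_hbar_deriv\<close>.\<close>

lemma laurent_expansion_subst_hbar:
  assumes A: "A > 0" and f: "laurent_expansion A (\<lambda>n. fls_nth f (int n)) g"
  defines "E \<equiv> fps_const (fls_const A) * (fps_const fls_X_inv - subst_hbar fls_X_inv)"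
  shows "laurent_expansion A (\<lambda>n. fls_nth (fps_nth (subst_hbar f) m) (int n))
           (fps_nth ((fps_exp 1 oo E) * subst_hbar g) m)"
proof (induction m)
  case 0
  show ?case
    using f by (simp add: E_def)
next
  case (Suc m)
  define F where "F = (fps_exp 1 oo E) * subst_hbar g"
  let ?S = "subst_hbar f"
  define D where "D = fls_X * fls_deriv (fps_nth F m) + fls_const A * fls_X_inv * fps_nth F m"
  have "fps_nth (fps_deriv F - 2 * (fps_X * fps_deriv F)) m
        = fps_nth (3 * (theta_coeffs F + fps_const (fls_const A * fls_X_inv) * F)) m"
    unfolding F_def E_def exp_subst_hbar_deriv ..
  then have rec: "of_nat (Suc m) * fps_nth F (Suc m) = 2 * (of_nat m * fps_nth F m) + 3 * D"
    unfolding fps_one_minus_2X_deriv_nth fps_numeral_mult_nth fps_add_nth fps_mult_left_const_nth theta_coeffs_nth D_def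
    by (simp only: diff_eq_eq add.commute)
  note IH = Suc.IH[folded F_def]
  have "laurent_expansion A (\<lambda>n. 1 / real (Suc m) * (2 * real m * fls_nth (fps_nth ?S m) (int n)
                                + 3 * (real n * fls_nth (fps_nth ?S m) (int n))))
          (fls_const (1 / real (Suc m)) * (fls_const (2 * real m) * fps_nth F m + fls_const 3 * D))"
    unfolding D_def
    by (intro laurent_expansion_cmult laurent_expansion_add laurent_expansion_theta A IH)
  also have "(\<lambda>n. 1 / real (Suc m) * (2 * real m * fls_nth (fps_nth ?S m) (int n)
                                + 3 * (real n * fls_nth (fps_nth ?S m) (int n))))
        = (\<lambda>n. fls_nth (fps_nth ?S (Suc m)) (int n))"
  proof
    fix n
    have "2 * real m * fls_nth (fps_nth ?S m) (int n) + 3 * (real n * fls_nth (fps_nth ?S m) (int n))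
        = real (Suc m) * fls_nth (fps_nth ?S (Suc m)) (int n)"
      unfolding subst_hbar_nth_Suc by (simp add: algebra_simps)
    then show "1 / real (Suc m) * (2 * real m * fls_nth (fps_nth ?S m) (int n)
                                + 3 * (real n * fls_nth (fps_nth ?S m) (int n)))
        = fls_nth (fps_nth ?S (Suc m)) (int n)"
      by (simp only:) simp
  qed
  also have "fls_const (1 / real (Suc m)) * (fls_const (2 * real m) * fps_nth F m + fls_const 3 * D) = fps_nth F (Suc m)"
  proof -
    have "fls_const (2 * real m) = 2 * of_nat m"
      by (simp add: fls_of_nat flip: fls_const_mult_const)
    then have "fls_const (2 * real m) * fps_nth F m + fls_const 3 * D = fls_const (real (Suc m)) * fps_nth F (Suc m)"
      using rec by (simp add: fls_of_nat mult.assoc del: of_nat_Suc)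
    then show ?thesis
      by (simp only: mult.assoc[symmetric] fls_const_mult_const) simp
  qed
  finally show ?case
    unfolding F_def .
qed

section \<open>Expansion of the free energy\<close>

lemma fps_funpow_deriv_nth_0:
  "fps_nth ((fps_deriv ^^ m) F) 0 = of_nat (fact m) * (fps_nth F m :: 'a :: comm_semiring_1)"
  by (induction m arbitrary: F) (simp_all add: funpow_Suc_right algebra_simps del: funpow.simps)

theorem mainTheorem5:
  shows "(\<forall>m. has_factorial_expansion (2/3) (fps_nth ((fps_deriv ^^ m) W) 0)) \<and>
         has_factorial_expansion (2/3) (fps_to_fls (fps_log Z0)) \<and>
         asymp_op_coeffwise (2/3) W =
           fps_const fls_X *
             (fps_compose (fps_exp 1)
                (fps_const (fls_const (2/3)) * (fps_const fls_X_inv - subst_hbar fls_X_inv)) *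
              subst_hbar (asymp_op (2/3) (fps_to_fls (fps_log Z0)))) \<and>
         asymp_op (2/3) (fps_to_fls (fps_log Z0)) =
           fps_to_fls (fps_const (1 / (2 * pi)) * (fps_compose Z0 (- fps_X) / Z0))"
proof -
  let ?L = "fps_to_fls (fps_log Z0)"
  define g where "g = fps_to_fls (fps_const (1 / (2 * pi)) * (fps_compose Z0 (- fps_X) / Z0))"
  define F where "F = fps_compose (fps_exp 1)
      (fps_const (fls_const (2/3)) * (fps_const fls_X_inv - subst_hbar fls_X_inv)) * subst_hbar g"
  have pos: "(2/3 :: real) > 0"
    by simp
  have "laurent_expansion (2/3) (fps_nth (fps_log Z0)) g"
    using laurent_expansion_fps_log[OF pos Z0_nth_0 laurent_expansion_Z0]
    unfolding g_def by (simp add: fps_divide_unit mult_ac)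
  then have L: "laurent_expansion (2/3) (\<lambda>n. fls_nth ?L (int n)) g"
    by simp
  have W: "laurent_expansion (2/3) (\<lambda>n. fls_nth (fps_nth W m) (int n)) (fls_X * fps_nth F m)" for m
  proof (rule laurent_expansion_shift[OF pos])
    define a where "a = fps_nth (one_minus_2j_powr (3/2) - 1 + fps_const 3 * fps_X) m"
    define b where "b = fps_nth (fps_log (1 / (1 - fps_const 2 * fps_X))) m"
    \<comment> \<open>The algebraic part sits in order \<open>hbar^0\<close> and the logarithm of
      \<open>1 / (1 - 2j)\<close> in \<open>hbar^1\<close>. After the shift the former is gone and
      the latter is left only at \<open>n = 0\<close>, so neither affects the expansion.\<close>
    have "fps_nth W m = fls_const (1/3) * fls_const a + fls_X * (fls_const (1/4) * fls_const b)
            + fls_X * fps_nth (subst_hbar ?L) m"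
      by (simp add: W_def a_def b_def const_coeffs_def algebra_simps)
    then have nth: "fls_nth (fps_nth W m) (int (Suc n))
            = (if n = 0 then 1/4 * b else 0) + fls_nth (fps_nth (subst_hbar ?L) m) (int n)" for n
      by (simp add: fls_X_times_conv_shift)
    have "eventually (\<lambda>n. (if n = 0 then 1/4 * b else 0) = 0) sequentially"
      using eventually_gt_at_top[of 0] by eventually_elim simp
    from laurent_expansion_add[OF pos laurent_expansion_zero[OF pos this] laurent_expansion_subst_hbar[OF pos L, of m]]
    show "laurent_expansion (2/3) (\<lambda>n. fls_nth (fps_nth W m) (int (Suc n))) (fps_nth F m)"
      unfolding nth F_def by simp
  qed
  have "has_factorial_expansion (2/3) (fps_nth ((fps_deriv ^^ m) W) 0)" for m
    using laurent_expansion_cmult[OF pos W, of "fact m" m]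
    by (intro laurent_expansion_imp_has_factorial_expansion[OF pos])
       (simp add: fps_funpow_deriv_nth_0 fls_of_nat)
  moreover have "asymp_op_coeffwise (2/3) W = fps_const fls_X * F"
    by (intro fps_ext) (simp add: asymp_op_coeffwise_def asymp_op_eqI[OF pos W])
  ultimately show ?thesis
    using laurent_expansion_imp_has_factorial_expansion[OF pos L]
    unfolding asymp_op_eqI[OF pos L] F_def g_def by blast
qed

end
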